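(* Let $N\ge3$ and let $R$ be an invertible charge-conserving operator on $V\otimes V$, $V=\mathbb C^N$. Then $R$ defines a strict monoidal functor $F$ from the braid category $\mathsf B$ to the category of rank-$N$ charge-conserving matrices with $F(1)=1$ and $F(\sigma)=R$ (equivalently, $R$ satisfies $(R\otimes 1_V)(1_V\otimes R)(R\otimes 1_V)=(1_V\otimes R)(R\otimes 1_V)(1_V\otimes R)$) if and only if each of the $\binom N3$ restrictions of $R$ to a three-element subset of $\{1,\dots,N\}$ (relabelled in order as $\{1,2,3\}$) satisfies the following equations together with their images under the action of $\Sigma_3$ by $\omega a_{ij}=a_{\omega(i)\omega(j)}$ and similarly for $b,c,d$: $$a_{12}(a_{11}^2-a_{12}a_{11}-b_{12}c_{12})=0,\qquad a_{12}(a_{22}^2-a_{12}a_{22}-b_{12}c_{12})=0,$$ $$a_{12}c_{12}d_{12}=0=a_{12}b_{12}d_{12},\qquad a_{12}d_{12}(a_{12}-d_{12})=0,$$ $$c_{12}(d_{13}d_{23}-d_{12}d_{23}-a_{12}d_{13})=0,\qquad c_{12}(-a_{13}a_{23}+a_{12}a_{23}+d_{12}a_{13})=0,$$ $$-a_{13}d_{23}^2+a_{13}^2d_{23}-a_{12}b_{23}c_{23}+a_{12}b_{13}c_{13}=0.$$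
   Context: Let $V=\mathbb C^N$ have standard basis $e_1,\dots,e_N$ and write $|ij\rangle=e_i\otimes e_j$. A linear operator $R$ on $V\otimes V$ is charge-conserving if there are scalars with $R|ii\rangle=a_{ii}|ii\rangle$ for all $i$, and for all $i<j$: $R|ij\rangle=a_{ij}|ij\rangle+b_{ij}|ji\rangle$, $R|ji\rangle=c_{ij}|ij\rangle+d_{ij}|ji\rangle$. For $i<j$ one also sets $a_{ji}=d_{ij}$, $d_{ji}=a_{ij}$, $b_{ji}=c_{ij}$, $c_{ji}=b_{ij}$. The restriction of $R$ to $\{i<j<k\}$ is the restriction of $R$ to $W\otimes W$, $W=\mathrm{span}(e_i,e_j,e_k)$, regarded as a charge-conserving operator on $\mathbb C^3\otimes\mathbb C^3$ by relabelling $i,j,k$ as $1,2,3$. The braid category $\mathsf B$ is the strict monoidal category with object monoid $(\mathbb N_0,+)$ generated by $\sigma,\sigma^{-1}\in\mathsf B(2,2)$ subject to $\sigma\sigma^{-1}=1_2=\sigma^{-1}\sigma$ and $(\sigma\otimes1_1)(1_1\otimes\sigma)(\sigma\otimes1_1)=(1_1\otimes\sigma)(\sigma\otimes1_1)(1_1\otimes\sigma)$. *)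

theory Defs
  imports Complex_Main "Jordan_Normal_Form.Matrix" "HOL-Combinatorics.Permutations"
begin

section \<open>Strict monoidal categories with object monoid the natural numbers under addition\<close>

text \<open>\<open>Comp C g f\<close> is the composite of \<open>g\<close> after \<open>f\<close>.\<close>

record 'a moncat =
  Hom :: "nat \<Rightarrow> nat \<Rightarrow> 'a set"
  Idt :: "nat \<Rightarrow> 'a"
  Comp :: "'a \<Rightarrow> 'a \<Rightarrow> 'a"
  Tens :: "'a \<Rightarrow> 'a \<Rightarrow> 'a"

locale strict_monoidal_category =
  fixes C :: "'a moncat"
  assumes id_in_hom: "Idt C n \<in> Hom C n n"
    and comp_in_hom: "\<lbrakk>f \<in> Hom C l m; g \<in> Hom C m n\<rbrakk> \<Longrightarrow> Comp C g f \<in> Hom C l n"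
    and tens_in_hom:
      "\<lbrakk>f \<in> Hom C m n; g \<in> Hom C m' n'\<rbrakk> \<Longrightarrow> Tens C f g \<in> Hom C (m + m') (n + n')"
    and comp_id_left: "f \<in> Hom C m n \<Longrightarrow> Comp C (Idt C n) f = f"
    and comp_id_right: "f \<in> Hom C m n \<Longrightarrow> Comp C f (Idt C m) = f"
    and comp_assoc: "\<lbrakk>f \<in> Hom C k l; g \<in> Hom C l m; h \<in> Hom C m n\<rbrakk>
      \<Longrightarrow> Comp C (Comp C h g) f = Comp C h (Comp C g f)"
    and tens_id: "Tens C (Idt C m) (Idt C n) = Idt C (m + n)"
    and interchange:
      "\<lbrakk>f \<in> Hom C l m; g \<in> Hom C m n; f' \<in> Hom C l' m'; g' \<in> Hom C m' n'\<rbrakk>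
      \<Longrightarrow> Comp C (Tens C g g') (Tens C f f') = Tens C (Comp C g f) (Comp C g' f')"
    and tens_assoc: "\<lbrakk>f \<in> Hom C m n; g \<in> Hom C m' n'; h \<in> Hom C m'' n''\<rbrakk>
      \<Longrightarrow> Tens C (Tens C f g) h = Tens C f (Tens C g h)"
    and tens_unit_left: "f \<in> Hom C m n \<Longrightarrow> Tens C (Idt C 0) f = f"
    and tens_unit_right: "f \<in> Hom C m n \<Longrightarrow> Tens C f (Idt C 0) = f"

locale strict_monoidal_functor =
  source: strict_monoidal_category C + target: strict_monoidal_category D
  for C :: "'a moncat" and D :: "'b moncat" +
  fixes Fo :: "nat \<Rightarrow> nat" and Fm :: "'a \<Rightarrow> 'b"
  assumes obj_unit: "Fo 0 = 0"
    and obj_tens: "Fo (m + n) = Fo m + Fo n"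
    and arr_in_hom: "f \<in> Hom C m n \<Longrightarrow> Fm f \<in> Hom D (Fo m) (Fo n)"
    and arr_id: "Fm (Idt C n) = Idt D (Fo n)"
    and arr_comp: "\<lbrakk>f \<in> Hom C l m; g \<in> Hom C m n\<rbrakk> \<Longrightarrow> Fm (Comp C g f) = Comp D (Fm g) (Fm f)"
    and arr_tens: "\<lbrakk>f \<in> Hom C m n; g \<in> Hom C m' n'\<rbrakk>
      \<Longrightarrow> Fm (Tens C f g) = Tens D (Fm f) (Fm g)"


section \<open>The braid category\<close>

text \<open>Arrows are the classes of well-formed expressions in the generators, modulo the least
  congruence containing the axioms of a strict monoidal category and the defining relations.\<close>

datatype bexp = BId nat | BSig | BInv | BComp bexp bexp | BTens bexp bexp

primrec src :: "bexp \<Rightarrow> nat" where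
  "src (BId n) = n"
| "src BSig = 2"
| "src BInv = 2"
| "src (BComp s t) = src t"
| "src (BTens s t) = src s + src t"

primrec tgt :: "bexp \<Rightarrow> nat" where
  "tgt (BId n) = n"
| "tgt BSig = 2"
| "tgt BInv = 2"
| "tgt (BComp s t) = tgt s"
| "tgt (BTens s t) = tgt s + tgt t"

primrec wf_bexp :: "bexp \<Rightarrow> bool" where
  "wf_bexp (BId n) \<longleftrightarrow> True"
| "wf_bexp BSig \<longleftrightarrow> True"
| "wf_bexp BInv \<longleftrightarrow> True"
| "wf_bexp (BComp s t) \<longleftrightarrow> wf_bexp s \<and> wf_bexp t \<and> src s = tgt t"
| "wf_bexp (BTens s t) \<longleftrightarrow> wf_bexp s \<and> wf_bexp t"

inductive beq :: "bexp \<Rightarrow> bexp \<Rightarrow> bool" where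
  beq_refl: "wf_bexp t \<Longrightarrow> beq t t"
| beq_sym: "beq s t \<Longrightarrow> beq t s"
| beq_trans: "\<lbrakk>beq s t; beq t u\<rbrakk> \<Longrightarrow> beq s u"
| beq_comp: "\<lbrakk>beq s s'; beq t t'; src s = tgt t\<rbrakk> \<Longrightarrow> beq (BComp s t) (BComp s' t')"
| beq_tens: "\<lbrakk>beq s s'; beq t t'\<rbrakk> \<Longrightarrow> beq (BTens s t) (BTens s' t')"
| beq_id_left: "wf_bexp t \<Longrightarrow> beq (BComp (BId (tgt t)) t) t"
| beq_id_right: "wf_bexp t \<Longrightarrow> beq (BComp t (BId (src t))) t"
| beq_comp_assoc: "wf_bexp (BComp (BComp s t) u) \<Longrightarrow>
    beq (BComp (BComp s t) u) (BComp s (BComp t u))"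
| beq_tens_id: "beq (BTens (BId m) (BId n)) (BId (m + n))"
| beq_interchange: "\<lbrakk>wf_bexp (BComp s t); wf_bexp (BComp s' t')\<rbrakk> \<Longrightarrow>
    beq (BComp (BTens s s') (BTens t t')) (BTens (BComp s t) (BComp s' t'))"
| beq_tens_assoc: "\<lbrakk>wf_bexp s; wf_bexp t; wf_bexp u\<rbrakk> \<Longrightarrow>
    beq (BTens (BTens s t) u) (BTens s (BTens t u))"
| beq_unit_left: "wf_bexp t \<Longrightarrow> beq (BTens (BId 0) t) t"
| beq_unit_right: "wf_bexp t \<Longrightarrow> beq (BTens t (BId 0)) t"
| beq_inv_right: "beq (BComp BSig BInv) (BId 2)"
| beq_inv_left: "beq (BComp BInv BSig) (BId 2)"
| beq_braid: "beq
    (BComp (BTens BSig (BId 1)) (BComp (BTens (BId 1) BSig) (BTens BSig (BId 1))))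
    (BComp (BTens (BId 1) BSig) (BComp (BTens BSig (BId 1)) (BTens (BId 1) BSig)))"

definition bclass :: "bexp \<Rightarrow> bexp set" where
  "bclass t = {u. beq t u}"

definition braid_cat :: "bexp set moncat" where
  "braid_cat = \<lparr>
     Hom = \<lambda>m n. {bclass t | t. wf_bexp t \<and> src t = m \<and> tgt t = n},
     Idt = \<lambda>n. bclass (BId n),
     Comp = \<lambda>X Y. \<Union>s\<in>X. \<Union>t\<in>Y. bclass (BComp s t),
     Tens = \<lambda>X Y. \<Union>s\<in>X. \<Union>t\<in>Y. bclass (BTens s t) \<rparr>"

definition braid_sigma :: "bexp set" where
  "braid_sigma = bclass BSig"


section \<open>Charge-conserving matrices\<close>

text \<open>Basis labels are \<open>0, \<dots>, N - 1\<close>, that is, shifted down by one. A linear map between tensor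
  powers of \<open>V\<close> is given by its matrix acting on column vectors. The basis of the \<open>n\<close>-th tensor
  power is ordered lexicographically: \<open>|w\<^sub>0 \<dots> w\<^sub>n\<^sub>-\<^sub>1\<rangle>\<close> has position
  \<open>\<Sum>k<n. w\<^sub>k N\<^sup>n\<^sup>-\<^sup>1\<^sup>-\<^sup>k\<close>; \<open>word N n p\<close> is the inverse of this.\<close>

definition kron :: "complex mat \<Rightarrow> complex mat \<Rightarrow> complex mat" where
  "kron A B = mat (dim_row A * dim_row B) (dim_col A * dim_col B)
     (\<lambda>(i, j). A $$ (i div dim_row B, j div dim_col B) * B $$ (i mod dim_row B, j mod dim_col B))"

definition word :: "nat \<Rightarrow> nat \<Rightarrow> nat \<Rightarrow> nat list" where
  "word N n p = map (\<lambda>k. p div N ^ (n - 1 - k) mod N) [0..<n]"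

definition match_cat :: "nat \<Rightarrow> complex mat moncat" where
  "match_cat N = \<lparr>
     Hom = \<lambda>m n. {A \<in> carrier_mat (N ^ n) (N ^ m). \<forall>p < N ^ n. \<forall>q < N ^ m.
       A $$ (p, q) \<noteq> 0 \<longrightarrow> mset (word N n p) = mset (word N m q)},
     Idt = \<lambda>n. 1\<^sub>m (N ^ n),
     Comp = (*),
     Tens = kron \<rparr>"

definition ket :: "nat \<Rightarrow> nat \<Rightarrow> nat \<Rightarrow> complex vec" where
  "ket N i j = unit_vec (N ^ 2) (i * N + j)"

definition charge_conserving :: "nat \<Rightarrow> complex mat \<Rightarrow> bool" where
  "charge_conserving N R \<longleftrightarrow> R \<in> carrier_mat (N ^ 2) (N ^ 2) \<and>
     (\<exists>a b c d :: nat \<Rightarrow> nat \<Rightarrow> complex.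
        (\<forall>i<N. R *\<^sub>v ket N i i = a i i \<cdot>\<^sub>v ket N i i) \<and>
        (\<forall>j<N. \<forall>i<j.
           R *\<^sub>v ket N i j = a i j \<cdot>\<^sub>v ket N i j + b i j \<cdot>\<^sub>v ket N j i \<and>
           R *\<^sub>v ket N j i = c i j \<cdot>\<^sub>v ket N i j + d i j \<cdot>\<^sub>v ket N j i))"

text \<open>The scalars of a charge-conserving \<open>R\<close>, read off as matrix entries. The same formulas for
  \<open>i < j\<close> and \<open>j < i\<close> give the convention \<open>a\<^sub>j\<^sub>i = d\<^sub>i\<^sub>j\<close>, \<open>b\<^sub>j\<^sub>i = c\<^sub>i\<^sub>j\<close>.\<close>

definition coeff_a :: "nat \<Rightarrow> complex mat \<Rightarrow> nat \<Rightarrow> nat \<Rightarrow> complex" where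
  "coeff_a N R i j = R $$ (i * N + j, i * N + j)"

definition coeff_b :: "nat \<Rightarrow> complex mat \<Rightarrow> nat \<Rightarrow> nat \<Rightarrow> complex" where
  "coeff_b N R i j = R $$ (j * N + i, i * N + j)"

definition coeff_c :: "nat \<Rightarrow> complex mat \<Rightarrow> nat \<Rightarrow> nat \<Rightarrow> complex" where
  "coeff_c N R i j = R $$ (i * N + j, j * N + i)"

definition coeff_d :: "nat \<Rightarrow> complex mat \<Rightarrow> nat \<Rightarrow> nat \<Rightarrow> complex" where
  "coeff_d N R i j = R $$ (j * N + i, j * N + i)"

definition yang_baxter :: "nat \<Rightarrow> complex mat \<Rightarrow> bool" where
  "yang_baxter N R \<longleftrightarrow>
     kron R (1\<^sub>m N) * kron (1\<^sub>m N) R * kron R (1\<^sub>m N) =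
     kron (1\<^sub>m N) R * kron R (1\<^sub>m N) * kron (1\<^sub>m N) R"

text \<open>The restriction to the span of \<open>e\<^sub>i, e\<^sub>j, e\<^sub>k\<close>, with \<open>i, j, k\<close> relabelled as \<open>0, 1, 2\<close>.\<close>

definition restriction3 :: "nat \<Rightarrow> complex mat \<Rightarrow> nat \<Rightarrow> nat \<Rightarrow> nat \<Rightarrow> complex mat" where
  "restriction3 N R i j k =
     (let pos = (\<lambda>p. [i, j, k] ! (p div 3) * N + [i, j, k] ! (p mod 3))
      in mat (3 ^ 2) (3 ^ 2) (\<lambda>(p, q). R $$ (pos p, pos q)))"

definition basic_constraints ::
  "(nat \<Rightarrow> nat \<Rightarrow> complex) \<Rightarrow> (nat \<Rightarrow> nat \<Rightarrow> complex) \<Rightarrow>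
   (nat \<Rightarrow> nat \<Rightarrow> complex) \<Rightarrow> (nat \<Rightarrow> nat \<Rightarrow> complex) \<Rightarrow> bool" where
  "basic_constraints a b c d \<longleftrightarrow>
     a 0 1 * ((a 0 0)^2 - a 0 1 * a 0 0 - b 0 1 * c 0 1) = 0 \<and>
     a 0 1 * ((a 1 1)^2 - a 0 1 * a 1 1 - b 0 1 * c 0 1) = 0 \<and>
     a 0 1 * c 0 1 * d 0 1 = 0 \<and>
     a 0 1 * b 0 1 * d 0 1 = 0 \<and>
     a 0 1 * d 0 1 * (a 0 1 - d 0 1) = 0 \<and>
     c 0 1 * (d 0 2 * d 1 2 - d 0 1 * d 1 2 - a 0 1 * d 0 2) = 0 \<and>
     c 0 1 * (- a 0 2 * a 1 2 + a 0 1 * a 1 2 + d 0 1 * a 0 2) = 0 \<and>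
     - a 0 2 * (d 1 2)^2 + (a 0 2)^2 * d 1 2 - a 0 1 * b 1 2 * c 1 2 + a 0 1 * b 0 2 * c 0 2 = 0"

definition rank3_constraints :: "complex mat \<Rightarrow> bool" where
  "rank3_constraints S \<longleftrightarrow> (\<forall>\<omega>. \<omega> permutes {0..<3} \<longrightarrow>
     basic_constraints
       (\<lambda>i j. coeff_a 3 S (\<omega> i) (\<omega> j)) (\<lambda>i j. coeff_b 3 S (\<omega> i) (\<omega> j))
       (\<lambda>i j. coeff_c 3 S (\<omega> i) (\<omega> j)) (\<lambda>i j. coeff_d 3 S (\<omega> i) (\<omega> j)))"

end

theory Submission
  imports Defs
begin

text \<open>Since the braid category is presented by generators and relations, a functor with
  \<open>\<sigma> \<mapsto> R\<close> exists as soon as \<open>R\<close> is invertible in the target and satisfies the braid relation. Applied to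
  \<open>|xyz\<rangle>\<close>, the two sides of the Yang-Baxter equation differ only by a combination of \<open>|xyz\<rangle>\<close>,
  \<open>|yxz\<rangle>\<close> and \<open>|xzy\<rangle>\<close>; the coefficients of \<open>|zxy\<rangle>\<close>, \<open>|yzx\<rangle>\<close> and \<open>|zyx\<rangle>\<close> cancel. The three remaining
  coefficients, for distinct labels and for the coincidences \<open>x = y\<close>, \<open>y = z\<close>, \<open>x = z\<close>, are up to sign the
  constraints and their images under permutations of the labels. A coincidence involves
  only two labels, and these extend to a triple because \<open>N \<ge> 3\<close>.\<close>


section \<open>The braid category\<close>

lemma bclass_eq: "beq s t \<Longrightarrow> bclass s = bclass t"
  unfolding bclass_def by (blast intro: beq_sym beq_trans)

lemma bclass_self: "wf_bexp t \<Longrightarrow> t \<in> bclass t"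
  by (simp add: bclass_def beq_refl)

lemma Hom_braid_cat:
  "X \<in> Hom braid_cat m n \<longleftrightarrow> (\<exists>t. X = bclass t \<and> wf_bexp t \<and> src t = m \<and> tgt t = n)"
  by (auto simp: braid_cat_def)

lemma Idt_braid_cat: "Idt braid_cat n = bclass (BId n)"
  by (simp add: braid_cat_def)

text \<open>Composition and tensor product of classes are unions over all pairs of representatives.
  Congruence makes such a family constant, and nonempty index sets let the union collapse to the
  common value.\<close>

lemma UN2_constant:
  assumes "\<And>x y. x \<in> A \<Longrightarrow> y \<in> B \<Longrightarrow> f x y = C" "a \<in> A" "b \<in> B"
  shows "(\<Union>x\<in>A. \<Union>y\<in>B. f x y) = C"
proof -
  have "(\<Union>x\<in>A. \<Union>y\<in>B. f x y) = (\<Union>x\<in>A. \<Union>y\<in>B. C)" using assms(1) by simp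
  then show ?thesis using assms(2,3) by auto
qed

lemma Comp_braid_cat:
  assumes "wf_bexp (BComp s t)"
  shows "Comp braid_cat (bclass s) (bclass t) = bclass (BComp s t)"
proof -
  \<comment> \<open>The equality is proved in reverse, which places the typing condition of
    \<open>beq_comp\<close> on \<open>s\<close> and \<open>t\<close>, where \<open>assms\<close>
    supplies it; no result on the types of \<open>s'\<close> and \<open>t'\<close> enters.\<close>
  have "bclass (BComp s' t') = bclass (BComp s t)" if "s' \<in> bclass s" "t' \<in> bclass t" for s' t'
    using that assms by (intro bclass_eq[symmetric] beq_comp) (auto simp: bclass_def)
  moreover have "s \<in> bclass s" "t \<in> bclass t" using assms by (auto intro: bclass_self)
  ultimately have "(\<Union>s'\<in>bclass s. \<Union>t'\<in>bclass t. bclass (BComp s' t')) = bclass (BComp s t)"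
    by (rule UN2_constant)
  then show ?thesis by (simp add: braid_cat_def)
qed

lemma Tens_braid_cat:
  assumes "wf_bexp (BTens s t)"
  shows "Tens braid_cat (bclass s) (bclass t) = bclass (BTens s t)"
proof -
  have "bclass (BTens s' t') = bclass (BTens s t)" if "s' \<in> bclass s" "t' \<in> bclass t" for s' t'
    using that by (intro bclass_eq[symmetric] beq_tens) (auto simp: bclass_def)
  moreover have "s \<in> bclass s" "t \<in> bclass t" using assms by (auto intro: bclass_self)
  ultimately have "(\<Union>s'\<in>bclass s. \<Union>t'\<in>bclass t. bclass (BTens s' t')) = bclass (BTens s t)"
    by (rule UN2_constant)
  then show ?thesis by (simp add: braid_cat_def)
qed

text \<open>On representatives each equational axiom is a generating clause of \<open>beq\<close>;
  the typing axioms follow by computing \<open>src\<close> and \<open>tgt\<close>.\<close>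

lemma strict_monoidal_braid_cat: "strict_monoidal_category braid_cat"
proof
  fix n show "Idt braid_cat n \<in> Hom braid_cat n n"
    by (auto simp: Idt_braid_cat Hom_braid_cat intro!: exI[of _ "BId n"])
next
  fix f g l m n assume "f \<in> Hom braid_cat l m" "g \<in> Hom braid_cat m n"
  then obtain s t where "f = bclass s" "g = bclass t" "wf_bexp s" "wf_bexp t"
    "src s = l" "tgt s = m" "src t = m" "tgt t = n" by (auto simp: Hom_braid_cat)
  then show "Comp braid_cat g f \<in> Hom braid_cat l n"
    by (auto simp: Comp_braid_cat Hom_braid_cat intro!: exI[of _ "BComp t s"])
next
  fix f g m n m' n' assume "f \<in> Hom braid_cat m n" "g \<in> Hom braid_cat m' n'"
  then obtain s t where "f = bclass s" "g = bclass t" "wf_bexp s" "wf_bexp t"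
    "src s = m" "tgt s = n" "src t = m'" "tgt t = n'" by (auto simp: Hom_braid_cat)
  then show "Tens braid_cat f g \<in> Hom braid_cat (m + m') (n + n')"
    by (auto simp: Tens_braid_cat Hom_braid_cat intro!: exI[of _ "BTens s t"])
next
  fix f m n assume "f \<in> Hom braid_cat m n"
  then obtain s where s: "f = bclass s" "wf_bexp s" "src s = m" "tgt s = n"
    by (auto simp: Hom_braid_cat)
  show "Comp braid_cat (Idt braid_cat n) f = f"
    using s beq_id_left[of s] by (simp add: Idt_braid_cat Comp_braid_cat bclass_eq)
  show "Comp braid_cat f (Idt braid_cat m) = f"
    using s beq_id_right[of s] by (simp add: Idt_braid_cat Comp_braid_cat bclass_eq)
  show "Tens braid_cat (Idt braid_cat 0) f = f"
    using s beq_unit_left[of s] by (simp add: Idt_braid_cat Tens_braid_cat bclass_eq)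
  show "Tens braid_cat f (Idt braid_cat 0) = f"
    using s beq_unit_right[of s] by (simp add: Idt_braid_cat Tens_braid_cat bclass_eq)
next
  fix f g h k l m n
  assume "f \<in> Hom braid_cat k l" "g \<in> Hom braid_cat l m" "h \<in> Hom braid_cat m n"
  then obtain s t u where "f = bclass s" "g = bclass t" "h = bclass u"
    "wf_bexp s" "wf_bexp t" "wf_bexp u"
    "tgt s = l" "src t = l" "tgt t = m" "src u = m" by (auto simp: Hom_braid_cat)
  then show "Comp braid_cat (Comp braid_cat h g) f = Comp braid_cat h (Comp braid_cat g f)"
    using beq_comp_assoc[of u t s] by (simp add: Comp_braid_cat bclass_eq)
next
  fix m n show "Tens braid_cat (Idt braid_cat m) (Idt braid_cat n) = Idt braid_cat (m + n)"
    by (simp add: Idt_braid_cat Tens_braid_cat bclass_eq beq_tens_id)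
next
  fix f g f' g' l m n l' m' n'
  assume "f \<in> Hom braid_cat l m" "g \<in> Hom braid_cat m n"
    "f' \<in> Hom braid_cat l' m'" "g' \<in> Hom braid_cat m' n'"
  then obtain s t s' t' where "f = bclass s" "g = bclass t" "f' = bclass s'" "g' = bclass t'"
    "wf_bexp s" "wf_bexp t" "wf_bexp s'" "wf_bexp t'"
    "tgt s = m" "src t = m" "tgt s' = m'" "src t' = m'" by (auto simp: Hom_braid_cat)
  then show "Comp braid_cat (Tens braid_cat g g') (Tens braid_cat f f') =
      Tens braid_cat (Comp braid_cat g f) (Comp braid_cat g' f')"
    using beq_interchange[of t s t' s'] by (simp add: Comp_braid_cat Tens_braid_cat bclass_eq)
next
  fix f g h m n m' n' m'' n''
  assume "f \<in> Hom braid_cat m n" "g \<in> Hom braid_cat m' n'" "h \<in> Hom braid_cat m'' n''"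
  then obtain s t u where "f = bclass s" "g = bclass t" "h = bclass u"
    "wf_bexp s" "wf_bexp t" "wf_bexp u" by (auto simp: Hom_braid_cat)
  then show "Tens braid_cat (Tens braid_cat f g) h = Tens braid_cat f (Tens braid_cat g h)"
    using beq_tens_assoc[of s t u] by (simp add: Tens_braid_cat bclass_eq)
qed

section \<open>The universal property of the braid category\<close>

definition braid_relation :: "'a moncat \<Rightarrow> 'a \<Rightarrow> bool" where
  "braid_relation D s \<longleftrightarrow>
     Comp D (Tens D s (Idt D 1)) (Comp D (Tens D (Idt D 1) s) (Tens D s (Idt D 1))) =
     Comp D (Tens D (Idt D 1) s) (Comp D (Tens D s (Idt D 1)) (Tens D (Idt D 1) s))"

primrec interp :: "'a moncat \<Rightarrow> 'a \<Rightarrow> 'a \<Rightarrow> bexp \<Rightarrow> 'a" where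
  "interp D s s' (BId n) = Idt D n"
| "interp D s s' BSig = s"
| "interp D s s' BInv = s'"
| "interp D s s' (BComp t u) = Comp D (interp D s s' t) (interp D s s' u)"
| "interp D s s' (BTens t u) = Tens D (interp D s s' t) (interp D s s' u)"

context strict_monoidal_category
begin

lemma interp_in_hom:
  assumes "s \<in> Hom C 2 2" "s' \<in> Hom C 2 2"
  shows "wf_bexp t \<Longrightarrow> interp C s s' t \<in> Hom C (src t) (tgt t)"
  using assms by (induction t) (auto intro: id_in_hom comp_in_hom tens_in_hom)

text \<open>Soundness of the interpretation. A clause of \<open>beq\<close> is an equivalence or
  congruence rule, an axiom that holds in \<open>C\<close>, or a defining relation; only the last
  kind draws on \<open>inv\<close> and \<open>braid\<close>.\<close>

lemma interp_beq:
  assumes s: "s \<in> Hom C 2 2" "s' \<in> Hom C 2 2"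
    and inv: "Comp C s s' = Idt C 2" "Comp C s' s = Idt C 2"
    and braid: "braid_relation C s"
  shows "beq t u \<Longrightarrow> interp C s s' t = interp C s s' u"
proof (induction rule: beq.induct)
  case (beq_comp_assoc t u v)
  then show ?case
    using interp_in_hom[OF s, of t] interp_in_hom[OF s, of u] interp_in_hom[OF s, of v]
    by (auto intro: comp_assoc)
next
  case (beq_interchange t u t' u')
  then show ?case
    using interp_in_hom[OF s, of t] interp_in_hom[OF s, of u]
      interp_in_hom[OF s, of t'] interp_in_hom[OF s, of u']
    by (auto intro: interchange)
next
  case (beq_tens_assoc t u v)
  then show ?case
    using interp_in_hom[OF s, of t] interp_in_hom[OF s, of u] interp_in_hom[OF s, of v]
    by (auto intro: tens_assoc)
next
  case (beq_id_left t)
  then show ?case using comp_id_left[OF interp_in_hom[OF s]] by simp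
next
  case (beq_id_right t)
  then show ?case using comp_id_right[OF interp_in_hom[OF s]] by simp
next
  case (beq_unit_left t)
  then show ?case using tens_unit_left[OF interp_in_hom[OF s]] by simp
next
  case (beq_unit_right t)
  then show ?case using tens_unit_right[OF interp_in_hom[OF s]] by simp
next
  case beq_braid
  then show ?case using braid by (simp add: braid_relation_def)
qed (use inv in \<open>simp_all add: tens_id\<close>)

text \<open>By soundness the interpretation descends to classes. It is then functorial and monoidal
  because the operations of \<open>braid_cat\<close> act on representatives as the constructors
  \<open>BComp\<close> and \<open>BTens\<close>.\<close>

lemma braid_functor_exists:
  assumes s: "s \<in> Hom C 2 2" "s' \<in> Hom C 2 2"
    and inv: "Comp C s s' = Idt C 2" "Comp C s' s = Idt C 2"
    and braid: "braid_relation C s"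
  shows "\<exists>Fm. strict_monoidal_functor braid_cat C id Fm \<and> Fm braid_sigma = s"
proof -
  \<comment> \<open>An arbitrary representative is interpreted; the next fact shows, through
    \<open>interp_beq\<close>, that the choice does not affect the value.\<close>
  define Fm where "Fm X = interp C s s' (SOME t. t \<in> X)" for X
  have Fm: "Fm (bclass t) = interp C s s' t" if "wf_bexp t" for t
  proof -
    have "(SOME u. u \<in> bclass t) \<in> bclass t"
      using bclass_self[OF that] by (rule someI)
    then have "beq t (SOME u. u \<in> bclass t)" by (simp add: bclass_def)
    then show ?thesis unfolding Fm_def by (metis interp_beq[OF s inv braid])
  qed
  interpret B: strict_monoidal_category braid_cat by (rule strict_monoidal_braid_cat)
  have "strict_monoidal_functor braid_cat C id Fm"
  proof
    fix f m n assume "f \<in> Hom braid_cat m n"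
    then show "Fm f \<in> Hom C (id m) (id n)"
      using interp_in_hom[OF s] by (auto simp: Hom_braid_cat Fm)
  next
    fix n show "Fm (Idt braid_cat n) = Idt C (id n)" by (simp add: Idt_braid_cat Fm)
  next
    fix f g l m n assume "f \<in> Hom braid_cat l m" "g \<in> Hom braid_cat m n"
    then show "Fm (Comp braid_cat g f) = Comp C (Fm g) (Fm f)"
      by (auto simp: Hom_braid_cat Fm Comp_braid_cat)
  next
    fix f g m n m' n' assume "f \<in> Hom braid_cat m n" "g \<in> Hom braid_cat m' n'"
    then show "Fm (Tens braid_cat f g) = Tens C (Fm f) (Fm g)"
      by (auto simp: Hom_braid_cat Fm Tens_braid_cat)
  qed auto
  moreover have "Fm braid_sigma = s" by (simp add: braid_sigma_def Fm)
  ultimately show ?thesis by blast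
qed

end

text \<open>As \<open>Fo 1 = 1\<close>, the identity strand goes to \<open>Idt D 1\<close>, so
  \<open>s\<close> tensored with a strand on either side goes to \<open>Fm s\<close> tensored with a
  strand on the same side. Applying \<open>Fm\<close> to both sides of the relation gives the
  claim.\<close>

lemma (in strict_monoidal_functor) braid_relation_image:
  assumes s: "s \<in> Hom C 2 2" and rel: "braid_relation C s" and Fo: "Fo 1 = 1"
  shows "braid_relation D (Fm s)"
proof -
  have 1: "Idt C 1 \<in> Hom C 1 1" by (rule source.id_in_hom)
  have t: "Tens C s (Idt C 1) \<in> Hom C 3 3" "Tens C (Idt C 1) s \<in> Hom C 3 3"
    using source.tens_in_hom[OF s 1] source.tens_in_hom[OF 1 s]
    unfolding numeral_plus_one one_plus_numeral by simp_all
  have "Fm (Tens C s (Idt C 1)) = Tens D (Fm s) (Idt D 1)"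
    "Fm (Tens C (Idt C 1) s) = Tens D (Idt D 1) (Fm s)"
    using arr_tens[OF s 1] arr_tens[OF 1 s] Fo by (simp_all add: arr_id)
  moreover have "Fm (Comp C f (Comp C g h)) = Comp D (Fm f) (Comp D (Fm g) (Fm h))"
    if "f \<in> Hom C 3 3" "g \<in> Hom C 3 3" "h \<in> Hom C 3 3" for f g h
    using that by (simp add: arr_comp[of _ 3 3 _ 3] source.comp_in_hom)
  ultimately show ?thesis
    using t arg_cong[OF rel[unfolded braid_relation_def], of Fm]
    unfolding braid_relation_def by simp
qed

lemma braid_sigma_in_hom: "braid_sigma \<in> Hom braid_cat 2 2"
  by (auto simp: braid_sigma_def Hom_braid_cat intro!: exI[of _ BSig])

lemma braid_relation_sigma: "braid_relation braid_cat braid_sigma"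
  using beq_braid
  by (simp add: braid_relation_def braid_sigma_def Idt_braid_cat Tens_braid_cat Comp_braid_cat
      bclass_eq)


section \<open>Charge-conserving matrices\<close>

lemma kron_carrier [simp]:
  "A \<in> carrier_mat m n \<Longrightarrow> B \<in> carrier_mat m' n' \<Longrightarrow> kron A B \<in> carrier_mat (m * m') (n * n')"
  by (auto simp: kron_def)

lemma index_kron:
  assumes "A \<in> carrier_mat m n" "B \<in> carrier_mat m' n'" "i < m * m'" "j < n * n'"
  shows "kron A B $$ (i, j) = A $$ (i div m', j div n') * B $$ (i mod m', j mod n')"
  using assms by (auto simp: kron_def)

text \<open>The range is cut into \<open>m\<close> blocks of length \<open>n\<close>: on block
  \<open>i\<close> the quotient is constantly \<open>i\<close>, while the remainder runs through all
  of \<open>0, ..., n - 1\<close>.\<close>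

lemma sum_div_mod:
  fixes f g :: "nat \<Rightarrow> 'a :: comm_semiring_0"
  shows "(\<Sum>k<m * n. f (k div n) * g (k mod n)) = (\<Sum>i<m. f i) * (\<Sum>j<n. g j)"
proof (cases "n = 0")
  case False
  have "(\<Sum>k<m * n. f (k div n) * g (k mod n)) = (\<Sum>i<m. \<Sum>k\<in>{i*n..<i*n+n}. f (k div n) * g (k mod n))"
    by (rule sum.nat_group[symmetric])
  also have "\<dots> = (\<Sum>i<m. \<Sum>j<n. f i * g j)"
  proof (rule sum.cong[OF refl])
    fix i
    have "(\<Sum>k\<in>{i*n..<i*n+n}. f (k div n) * g (k mod n)) =
        (\<Sum>j\<in>{0..<n}. f ((j + i * n) div n) * g ((j + i * n) mod n))"
      using sum.shift_bounds_nat_ivl[of "\<lambda>k. f (k div n) * g (k mod n)" 0 "i*n" n]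
      by (simp add: add.commute)
    then show "(\<Sum>k\<in>{i*n..<i*n+n}. f (k div n) * g (k mod n)) = (\<Sum>j<n. f i * g j)"
      using False by (simp add: lessThan_atLeast0)
  qed
  finally show ?thesis by (simp add: sum_product)
qed simp

lemma div_less_mult: "i < m * n \<Longrightarrow> i div n < (m :: nat)"
  by (simp add: less_mult_imp_div_less)

lemma mod_less_mult: "i < m * n \<Longrightarrow> i mod n < (n :: nat)"
  by (cases "n = 0") auto

text \<open>The mixed product rule, which becomes the interchange law. The quotient and the
  remainder of the summation index by \<open>m'\<close> vary independently, so
  \<open>sum_div_mod\<close> factors the sum.\<close>

lemma kron_mult:
  assumes A: "A \<in> carrier_mat l m" and B: "B \<in> carrier_mat m n"
    and A': "A' \<in> carrier_mat l' m'" and B': "B' \<in> carrier_mat m' n'"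
  shows "kron A A' * kron B B' = kron (A * B) (A' * B')"
proof (rule eq_matI)
  have k: "kron A A' \<in> carrier_mat (l * l') (m * m')" "kron B B' \<in> carrier_mat (m * m') (n * n')"
    "kron (A * B) (A' * B') \<in> carrier_mat (l * l') (n * n')"
    using assms by auto
  then show "dim_row (kron A A' * kron B B') = dim_row (kron (A * B) (A' * B'))"
    "dim_col (kron A A' * kron B B') = dim_col (kron (A * B) (A' * B'))" by auto
  fix i j assume "i < dim_row (kron (A * B) (A' * B'))" "j < dim_col (kron (A * B) (A' * B'))"
  then have i: "i < l * l'" and j: "j < n * n'" using k by auto
  have "(kron A A' * kron B B') $$ (i, j) =
      (\<Sum>k<m * m'. kron A A' $$ (i, k) * kron B B' $$ (k, j))"
    using k i j by (auto simp: scalar_prod_def lessThan_atLeast0)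
  also have "\<dots> = (\<Sum>k<m * m'. (A $$ (i div l', k div m') * B $$ (k div m', j div n')) *
       (A' $$ (i mod l', k mod m') * B' $$ (k mod m', j mod n')))"
    using i j by (intro sum.cong refl)
      (simp add: index_kron[OF A A'] index_kron[OF B B'] mult_ac)
  also have "\<dots> = (\<Sum>k<m. A $$ (i div l', k) * B $$ (k, j div n')) *
       (\<Sum>k<m'. A' $$ (i mod l', k) * B' $$ (k, j mod n'))"
    by (rule sum_div_mod)
  also have "\<dots> = (A * B) $$ (i div l', j div n') * (A' * B') $$ (i mod l', j mod n')"
    using assms div_less_mult[OF i] div_less_mult[OF j] mod_less_mult[OF i] mod_less_mult[OF j]
    by (auto simp: scalar_prod_def lessThan_atLeast0)
  also have "\<dots> = kron (A * B) (A' * B') $$ (i, j)"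
    using i j assms by (simp add: index_kron[of _ l n _ l' n'])
  finally show "(kron A A' * kron B B') $$ (i, j) = kron (A * B) (A' * B') $$ (i, j)" .
qed

text \<open>Associativity is strict because both bracketings split an index into the same three
  mixed-radix digits; \<open>aux\<close> compares the two ways of extracting them.\<close>

lemma kron_assoc: "kron (kron A B) C = kron A (kron B C)"
proof (rule eq_matI)
  fix i j
  assume "i < dim_row (kron A (kron B C))" "j < dim_col (kron A (kron B C))"
  then have i: "i < dim_row A * dim_row B * dim_row C" and j: "j < dim_col A * dim_col B * dim_col C"
    by (auto simp: kron_def mult.assoc)
  have aux: "i div c div b = i div (b * c)" "i mod (b * c) div c = i div c mod b"
    "i mod (b * c) mod c = i mod c" for i b c :: nat
  proof -
    show "i div c div b = i div (b * c)" by (metis div_mult2_eq mult.commute)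
    show "i mod (b * c) div c = i div c mod b"
      by (cases "c = 0") (simp_all add: mult.commute[of b] mod_mult2_eq)
    show "i mod (b * c) mod c = i mod c" by (simp add: mod_mod_cancel)
  qed
  have ij: "i < dim_row A * (dim_row B * dim_row C)" "j < dim_col A * (dim_col B * dim_col C)"
    using i j by (simp_all add: mult.assoc)
  show "kron (kron A B) C $$ (i, j) = kron A (kron B C) $$ (i, j)"
    using i j ij div_less_mult[OF i] div_less_mult[OF j] mod_less_mult[OF ij(1)] mod_less_mult[OF ij(2)]
    by (simp add: kron_def aux mult.assoc)
qed (simp_all add: kron_def mult.assoc)

lemma kron_one: "kron (1\<^sub>m m) (1\<^sub>m n) = 1\<^sub>m (m * n)"
proof (rule eq_matI)
  fix i j assume "i < dim_row (1\<^sub>m (m * n) :: complex mat)" "j < dim_col (1\<^sub>m (m * n) :: complex mat)"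
  then have i: "i < m * n" and j: "j < m * n" by auto
  have "i div n = j div n \<and> i mod n = j mod n \<longleftrightarrow> i = j" by (metis div_mult_mod_eq)
  then show "kron (1\<^sub>m m) (1\<^sub>m n) $$ (i, j) = 1\<^sub>m (m * n) $$ (i, j)"
    using i j div_less_mult[OF i] div_less_mult[OF j] mod_less_mult[OF i] mod_less_mult[OF j]
    by (auto simp: kron_def)
qed (simp_all add: kron_def)

lemma kron_one_left: "kron (1\<^sub>m 1) A = A"
  by (rule eq_matI) (auto simp: kron_def)

lemma kron_one_right: "kron A (1\<^sub>m 1) = A"
  by (rule eq_matI) (auto simp: kron_def)

section \<open>Charge-conserving matrices as a strict monoidal category\<close>

lemma word_append:
  assumes "N > 0"
  shows "word N (m + n) p = word N m (p div N ^ n) @ word N n (p mod N ^ n)"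
proof (rule nth_equalityI)
  fix k assume "k < length (word N (m + n) p)"
  then have k: "k < m + n" by (simp add: word_def)
  show "word N (m + n) p ! k = (word N m (p div N ^ n) @ word N n (p mod N ^ n)) ! k"
  proof (cases "k < m")
    case True
    then have "m + n - 1 - k = n + (m - 1 - k)" by simp
    then have "N ^ (m + n - 1 - k) = N ^ n * N ^ (m - 1 - k)"
      by (simp only: power_add)
    with True show ?thesis by (simp add: word_def nth_append div_mult2_eq)
  next
    case False
    \<comment> \<open>\<open>e\<close> is the exponent of the power of \<open>N\<close> that weighs
      letter \<open>k\<close>. Since \<open>N ^ n\<close> is a multiple of \<open>N ^ e * N\<close>,
      reduction modulo \<open>N ^ n\<close> leaves this digit unchanged.\<close>
    define e where "e = m + n - 1 - k"
    have e: "n = e + (1 + (n - 1 - e))" "n - 1 - (k - m) = e" using False k by (auto simp: e_def)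
    have "N ^ n = N ^ e * (N * N ^ (n - 1 - e))"
      by (subst e(1)) (simp only: power_add power_one_right)
    then have "p mod N ^ n div N ^ e mod N = p div N ^ e mod N"
      using assms by (simp add: mod_mult2_eq)
    moreover have "m + n - Suc k = e" by (simp add: e_def)
    moreover have "k - m < n" using False k by simp
    ultimately show ?thesis using False k e(2) by (simp add: word_def nth_append)
  qed
qed (simp add: word_def)

lemma Hom_match_cat:
  "A \<in> Hom (match_cat N) m n \<longleftrightarrow> A \<in> carrier_mat (N ^ n) (N ^ m) \<and>
     (\<forall>p < N ^ n. \<forall>q < N ^ m. A $$ (p, q) \<noteq> 0 \<longrightarrow> mset (word N n p) = mset (word N m q))"
  by (simp add: match_cat_def)

lemma match_cat_simps [simp]:
  "Idt (match_cat N) n = 1\<^sub>m (N ^ n)" "Comp (match_cat N) = (*)" "Tens (match_cat N) = kron"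
  by (simp_all add: match_cat_def)

lemma strict_monoidal_match_cat:
  assumes "N > 0"
  shows "strict_monoidal_category (match_cat N)"
proof
  fix n show "Idt (match_cat N) n \<in> Hom (match_cat N) n n"
    by (auto simp: Hom_match_cat split: if_splits)
next
  fix f g l m n assume f: "f \<in> Hom (match_cat N) l m" and g: "g \<in> Hom (match_cat N) m n"
  have "mset (word N n p) = mset (word N l q)"
    if pq: "p < N ^ n" "q < N ^ l" and nz: "(g * f) $$ (p, q) \<noteq> 0" for p q
  proof -
    have "(g * f) $$ (p, q) = (\<Sum>k<N ^ m. g $$ (p, k) * f $$ (k, q))"
      using pq f g by (auto simp: Hom_match_cat scalar_prod_def lessThan_atLeast0)
    \<comment> \<open>A nonzero entry of a product needs an intermediate index \<open>k\<close> at
      which both factors are nonzero; the charge is then carried from \<open>q\<close> through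
      \<open>k\<close> to \<open>p\<close>.\<close>
    with nz obtain k where "k < N ^ m" "g $$ (p, k) * f $$ (k, q) \<noteq> 0"
      by (metis (no_types, lifting) lessThan_iff sum.neutral)
    then show ?thesis using pq f g by (auto simp: Hom_match_cat)
  qed
  with f g show "Comp (match_cat N) g f \<in> Hom (match_cat N) l n"
    by (auto simp: Hom_match_cat)
next
  fix f g m n m' n' assume f: "f \<in> Hom (match_cat N) m n" and g: "g \<in> Hom (match_cat N) m' n'"
  have fc: "f \<in> carrier_mat (N ^ n) (N ^ m)" "g \<in> carrier_mat (N ^ n') (N ^ m')"
    using f g by (auto simp: Hom_match_cat)
  have "mset (word N (n + n') p) = mset (word N (m + m') q)"
    if p: "p < N ^ n * N ^ n'" and q: "q < N ^ m * N ^ m'" and nz: "kron f g $$ (p, q) \<noteq> 0" for p q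
  proof -
    \<comment> \<open>Both factors must be nonzero, so charge is conserved separately in the leading
      and the trailing letters; \<open>word_append\<close> adds the two charges.\<close>
    have "f $$ (p div N ^ n', q div N ^ m') \<noteq> 0" "g $$ (p mod N ^ n', q mod N ^ m') \<noteq> 0"
      using nz by (auto simp: index_kron[OF fc p q])
    then show ?thesis
      using f g div_less_mult[OF p] div_less_mult[OF q] mod_less_mult[OF p] mod_less_mult[OF q]
      by (simp add: Hom_match_cat word_append[OF assms])
  qed
  then show "Tens (match_cat N) f g \<in> Hom (match_cat N) (m + m') (n + n')"
    using fc by (auto simp: Hom_match_cat power_add)
next
  fix f g h k l m n
  assume "f \<in> Hom (match_cat N) k l" "g \<in> Hom (match_cat N) l m" "h \<in> Hom (match_cat N) m n"
  then show "Comp (match_cat N) (Comp (match_cat N) h g) f =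
      Comp (match_cat N) h (Comp (match_cat N) g f)"
    by (auto simp: Hom_match_cat intro: assoc_mult_mat)
next
  fix f g f' g' l m n l' m' n'
  assume "f \<in> Hom (match_cat N) l m" "g \<in> Hom (match_cat N) m n"
    "f' \<in> Hom (match_cat N) l' m'" "g' \<in> Hom (match_cat N) m' n'"
  then show "Comp (match_cat N) (Tens (match_cat N) g g') (Tens (match_cat N) f f') =
      Tens (match_cat N) (Comp (match_cat N) g f) (Comp (match_cat N) g' f')"
    by (auto simp: Hom_match_cat intro: kron_mult)
qed (auto simp: Hom_match_cat kron_one kron_assoc kron_one_left[simplified]
    kron_one_right[simplified] power_add)

text \<open>An arrow commutes with the projection onto the vectors of a given charge, hence so does its
  inverse.\<close>

lemma match_cat_inverse:
  assumes R: "R \<in> Hom (match_cat N) n n" and B: "B \<in> carrier_mat (N ^ n) (N ^ n)"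
    and RB: "R * B = 1\<^sub>m (N ^ n)" and BR: "B * R = 1\<^sub>m (N ^ n)"
  shows "B \<in> Hom (match_cat N) n n"
proof -
  let ?d = "N ^ n"
  let ?ch = "\<lambda>p. mset (word N n p)"
  have Rc: "R \<in> carrier_mat ?d ?d" using R by (simp add: Hom_match_cat)
  have "B $$ (p, q) = 0" if pq: "p < ?d" "q < ?d" and ne: "?ch p \<noteq> ?ch q" for p q
  proof -
    \<comment> \<open>The projection is onto the charge of the column index \<open>q\<close>: right
      multiplication by it keeps the entry \<open>(p, q)\<close> of \<open>B\<close>, left
      multiplication kills that entry since \<open>p\<close> has another charge.\<close>
    define P where "P = mat ?d ?d (\<lambda>(i, j). if i = j \<and> ?ch i = ?ch q then 1 else (0 :: complex))"
    have P: "P \<in> carrier_mat ?d ?d" by (simp add: P_def)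
    have PM: "(P * M) $$ (i, j) = (if ?ch i = ?ch q then M $$ (i, j) else 0)"
      "(M * P) $$ (i, j) = (if ?ch j = ?ch q then M $$ (i, j) else 0)"
      if "M \<in> carrier_mat ?d ?d" "i < ?d" "j < ?d" for M i j
    proof -
      have "(P * M) $$ (i, j) = (\<Sum>k<?d. P $$ (i, k) * M $$ (k, j))"
        using that P by (auto simp: scalar_prod_def lessThan_atLeast0)
      also have "\<dots> = (\<Sum>k<?d. if k = i then (if ?ch i = ?ch q then M $$ (i, j) else 0) else 0)"
        using that by (intro sum.cong) (auto simp: P_def)
      finally show "(P * M) $$ (i, j) = (if ?ch i = ?ch q then M $$ (i, j) else 0)"
        using that by simp
      have "(M * P) $$ (i, j) = (\<Sum>k<?d. M $$ (i, k) * P $$ (k, j))"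
        using that P by (auto simp: scalar_prod_def lessThan_atLeast0)
      also have "\<dots> = (\<Sum>k<?d. if k = j then (if ?ch j = ?ch q then M $$ (i, j) else 0) else 0)"
        using that by (intro sum.cong) (auto simp: P_def)
      finally show "(M * P) $$ (i, j) = (if ?ch j = ?ch q then M $$ (i, j) else 0)"
        using that by simp
    qed
    have PR: "P * R = R * P"
    proof (rule eq_matI)
      fix i j assume "i < dim_row (R * P)" "j < dim_col (R * P)"
      then have ij: "i < ?d" "j < ?d" using Rc P by auto
      then have "R $$ (i, j) = 0" if "?ch i \<noteq> ?ch j"
        using R that by (auto simp: Hom_match_cat)
      then show "(P * R) $$ (i, j) = (R * P) $$ (i, j)"
        unfolding PM[OF Rc ij] by (metis (full_types))
    qed (use Rc P in auto)
    \<comment> \<open>Commutation with \<open>R\<close> passes to the inverse: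
      \<open>B P = B P R B = B R P B = P B\<close>.\<close>
    have "B * P = B * (P * (R * B))" using P by (simp add: RB)
    also have "\<dots> = B * (R * P * B)"
      using assoc_mult_mat[OF P Rc B] by (simp add: PR)
    also have "\<dots> = B * R * (P * B)"
      using B P Rc by (simp add: assoc_mult_mat[of _ ?d ?d _ ?d _ ?d] mult_carrier_mat[of _ ?d ?d])
    also have "\<dots> = P * B" using P B by (simp add: BR)
    finally have "(B * P) $$ (p, q) = (P * B) $$ (p, q)" by simp
    then show ?thesis using ne by (simp add: PM[OF B pq])
  qed
  then show ?thesis using B by (auto simp: Hom_match_cat)
qed

section \<open>Entries of charge-conserving operators\<close>

lemma square_index_less:
  "i < N \<Longrightarrow> j < N \<Longrightarrow> i * N + j < (N :: nat) ^ 2"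
proof -
  assume "i < N" "j < N"
  then have "i * N + j < (i + 1) * N" by simp
  also have "\<dots> \<le> N * N" using \<open>i < N\<close> by (intro mult_right_mono) auto
  finally show ?thesis by (simp add: power2_eq_square)
qed

lemma square_index_cases:
  assumes "p < (N :: nat) ^ 2"
  obtains i j where "i < N" "j < N" "p = i * N + j"
proof
  have "p < N * N" using assms by (simp add: power2_eq_square)
  then show "p div N < N" "p mod N < N" by (auto intro: div_less_mult mod_less_mult)
qed simp

lemma index_eq_iff:
  "j < n \<Longrightarrow> j' < n \<Longrightarrow> i * n + j = i' * n + j' \<longleftrightarrow> i = i' \<and> j = (j' :: nat)"
  by (metis add.commute div_mult_self3 mod_mult_self3 add_cancel_right_left div_less mod_less
      not_less_zero)

text \<open>\<open>coeff_b\<close> on the diagonal is the same matrix entry as \<open>coeff_a\<close>. Setting it to zero there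
  makes \<open>R|ij\<rangle> = a\<^sub>i\<^sub>j|ij\<rangle> + b\<^sub>i\<^sub>j|ji\<rangle>\<close> valid for all \<open>i\<close>, \<open>j\<close>.\<close>

definition swap_coeff :: "nat \<Rightarrow> complex mat \<Rightarrow> nat \<Rightarrow> nat \<Rightarrow> complex" where
  "swap_coeff N R i j = (if i = j then 0 else coeff_b N R i j)"

lemma charge_conserving_index:
  assumes cc: "charge_conserving N R" and p: "p < N ^ 2" and ij: "i < N" "j < N"
  shows "R $$ (p, i * N + j) =
    (if p = i * N + j then coeff_a N R i j else 0) + (if p = j * N + i then swap_coeff N R i j else 0)"
proof -
  obtain a b c d where Rc: "R \<in> carrier_mat (N ^ 2) (N ^ 2)"
    and diag: "\<And>i. i < N \<Longrightarrow> R *\<^sub>v ket N i i = a i i \<cdot>\<^sub>v ket N i i"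
    and ab: "\<And>i j. j < N \<Longrightarrow> i < j \<Longrightarrow> R *\<^sub>v ket N i j = a i j \<cdot>\<^sub>v ket N i j + b i j \<cdot>\<^sub>v ket N j i"
    and cd: "\<And>i j. j < N \<Longrightarrow> i < j \<Longrightarrow> R *\<^sub>v ket N j i = c i j \<cdot>\<^sub>v ket N i j + d i j \<cdot>\<^sub>v ket N j i"
    using cc unfolding charge_conserving_def by blast
  have col: "(R *\<^sub>v ket N i j) $ p = R $$ (p, i * N + j)" if "p < N ^ 2" for p
    using Rc that square_index_less[OF ij] by (simp add: ket_def)
  consider "i = j" | "i < j" | "j < i" by linarith
  \<comment> \<open>For \<open>i = j\<close> the two kets coincide and only \<open>u + v\<close> is
    determined; requiring \<open>v = 0\<close> matches the diagonal convention of
    \<open>swap_coeff\<close>.\<close>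
  then obtain u v where uv: "R *\<^sub>v ket N i j = u \<cdot>\<^sub>v ket N i j + v \<cdot>\<^sub>v ket N j i"
    "i = j \<Longrightarrow> v = 0"
  proof cases
    case 1
    have "R *\<^sub>v ket N i j = a i i \<cdot>\<^sub>v ket N i j + 0 \<cdot>\<^sub>v ket N j i"
      using diag[OF ij(1)] 1 by (auto simp: ket_def)
    then show ?thesis using that by blast
  next
    case 2
    then show ?thesis using that ab[OF ij(2)] by blast
  next
    \<comment> \<open>The pair is in descending order, so the scalars are those of the ascending
      pair \<open>j\<close>, \<open>i\<close> with \<open>d\<close> in place of \<open>a\<close> and
      \<open>c\<close> in place of \<open>b\<close>.\<close>
    case 3
    have "R *\<^sub>v ket N i j = d j i \<cdot>\<^sub>v ket N i j + c j i \<cdot>\<^sub>v ket N j i"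
      using cd[OF ij(1) 3] by (simp add: ket_def comm_add_vec[of _ "N ^ 2"])
    then show ?thesis using that 3 by blast
  qed
  have ent: "R $$ (p, i * N + j) = (if p = i * N + j then u else 0) + (if p = j * N + i then v else 0)"
    if "p < N ^ 2" for p
    using that col[OF that] square_index_less[OF ij] square_index_less[OF ij(2) ij(1)]
    unfolding uv(1) by (auto simp: ket_def)
  have ne: "i * N + j = j * N + i \<longleftrightarrow> i = j" "j * N + i = i * N + j \<longleftrightarrow> i = j"
    using index_eq_iff[OF ij(2,1)] by metis+
  have "u = coeff_a N R i j"
    using ent[OF square_index_less[OF ij]] uv(2) by (simp add: ne coeff_a_def)
  moreover have "v = swap_coeff N R i j"
    using ent[OF square_index_less[OF ij(2) ij(1)]] uv(2)
    by (simp add: ne swap_coeff_def coeff_b_def)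
  ultimately show ?thesis using ent[OF p] by simp
qed

lemma word_two: "i < N \<Longrightarrow> j < N \<Longrightarrow> word N 2 (i * N + j) = [i, j]"
  by (simp add: word_def numeral_2_eq_2)

lemma charge_conserving_hom:
  assumes "charge_conserving N R"
  shows "R \<in> Hom (match_cat N) 2 2"
proof -
  have "mset (word N 2 p) = mset (word N 2 q)"
    if p: "p < N ^ 2" and q: "q < N ^ 2" and nz: "R $$ (p, q) \<noteq> 0" for p q
  proof -
    obtain i j where q: "i < N" "j < N" "q = i * N + j" using q by (rule square_index_cases)
    then have "p = i * N + j \<or> p = j * N + i"
      using nz charge_conserving_index[OF assms p, of i j] by (auto split: if_splits)
    then show ?thesis using q by (auto simp: word_two)
  qed
  then show ?thesis using assms by (auto simp: Hom_match_cat charge_conserving_def)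
qed

section \<open>Functors and the Yang-Baxter equation\<close>

lemma braid_relation_match_cat:
  assumes "R \<in> carrier_mat (N ^ 2) (N ^ 2)"
  shows "braid_relation (match_cat N) R \<longleftrightarrow> yang_baxter N R"
proof -
  have "kron R (1\<^sub>m N) \<in> carrier_mat (N ^ 3) (N ^ 3)" "kron (1\<^sub>m N) R \<in> carrier_mat (N ^ 3) (N ^ 3)"
    using kron_carrier[OF assms one_carrier_mat[of N]] kron_carrier[OF one_carrier_mat[of N] assms]
    by (simp_all add: power3_eq_cube power2_eq_square mult.assoc)
  \<comment> \<open>The two predicates differ in bracketing: \<open>braid_relation\<close>
    associates its triple products to the right, \<open>yang_baxter\<close> to the left.\<close>
  then show ?thesis
    by (simp add: braid_relation_def yang_baxter_def assoc_mult_mat[of _ "N ^ 3" "N ^ 3" _ "N ^ 3" _ "N ^ 3"])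
qed

text \<open>A functor carries the braid relation of \<open>braid_sigma\<close> to \<open>R\<close>.
  Conversely the universal property applies, \<open>match_cat_inverse\<close> providing the inverse
  of \<open>R\<close> as an arrow of the target.\<close>

lemma functor_iff_yang_baxter:
  assumes "N > 0" and cc: "charge_conserving N R" and inv: "invertible_mat R"
  shows "(\<exists>Fo Fm. strict_monoidal_functor braid_cat (match_cat N) Fo Fm \<and>
      Fo 1 = 1 \<and> Fm braid_sigma = R) \<longleftrightarrow> yang_baxter N R"
proof
  have Rc: "R \<in> carrier_mat (N ^ 2) (N ^ 2)" using cc by (simp add: charge_conserving_def)
  {
    assume "\<exists>Fo Fm. strict_monoidal_functor braid_cat (match_cat N) Fo Fm \<and>
      Fo 1 = 1 \<and> Fm braid_sigma = R"
    then show "yang_baxter N R"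
      using strict_monoidal_functor.braid_relation_image[OF _ braid_sigma_in_hom braid_relation_sigma]
        braid_relation_match_cat[OF Rc] by blast
  }
  assume yb: "yang_baxter N R"
  interpret M: strict_monoidal_category "match_cat N"
    using assms(1) by (rule strict_monoidal_match_cat)
  obtain B where RB: "R * B = 1\<^sub>m (N ^ 2)" and BR': "B * R = 1\<^sub>m (dim_row B)"
    using inv Rc by (auto simp: invertible_mat_def inverts_mat_def)
  \<comment> \<open>Comparing column counts in \<open>R B = 1\<close> and \<open>B R = 1\<close>
    gives \<open>dim_col B\<close> and \<open>dim_row B\<close> respectively.\<close>
  have B: "B \<in> carrier_mat (N ^ 2) (N ^ 2)"
    using arg_cong[OF RB, of dim_col] arg_cong[OF BR', of dim_col] Rc by auto
  then have BR: "B * R = 1\<^sub>m (N ^ 2)" using BR' by simp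
  have R: "R \<in> Hom (match_cat N) 2 2" using cc by (rule charge_conserving_hom)
  obtain Fm where "strict_monoidal_functor braid_cat (match_cat N) id Fm" "Fm braid_sigma = R"
    using M.braid_functor_exists[OF R match_cat_inverse[OF R B RB BR]] RB BR yb
      braid_relation_match_cat[OF Rc] by auto
  then show "\<exists>Fo Fm. strict_monoidal_functor braid_cat (match_cat N) Fo Fm \<and>
      Fo 1 = 1 \<and> Fm braid_sigma = R" by (intro exI[of _ id] exI[of _ Fm]) auto
qed


section \<open>The Yang-Baxter equation in coordinates\<close>

lemma charge_conserving_index_pair:
  assumes cc: "charge_conserving N R" and "i < N" "j < N" "i' < N" "j' < N"
  shows "R $$ (i' * N + j', i * N + j) =
    (if i' = i \<and> j' = j then coeff_a N R i j else 0) +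
    (if i' = j \<and> j' = i then swap_coeff N R i j else 0)"
  unfolding charge_conserving_index[OF cc square_index_less[OF assms(4,5)] assms(2,3)]
    index_eq_iff[OF assms(5,3)] index_eq_iff[OF assms(5,2)] ..

section \<open>Basis vectors of the third tensor power\<close>

definition ket3 :: "nat \<Rightarrow> nat \<Rightarrow> nat \<Rightarrow> nat \<Rightarrow> complex vec" where
  "ket3 N x y z = unit_vec (N ^ 3) ((x * N + y) * N + z)"

lemma ket3_carrier [simp]: "ket3 N x y z \<in> carrier_vec (N ^ 3)"
  by (simp add: ket3_def)

lemma cube_index_less:
  assumes "x < N" "y < N" "z < N"
  shows "(x * N + y) * N + z < (N :: nat) ^ 3"
proof -
  have "(x * N + y) * N + z < (x * N + y + 1) * N" using assms by simp
  also have "\<dots> \<le> N ^ 2 * N"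
    using square_index_less[OF assms(1,2)] by (intro mult_right_mono) auto
  finally show ?thesis by (simp add: eval_nat_numeral mult_ac)
qed

lemma index_ket3:
  assumes "x < N" "y < N" "z < N" "x' < N" "y' < N" "z' < N"
  shows "ket3 N x y z $ ((x' * N + y') * N + z') = (if x' = x \<and> y' = y \<and> z' = z then 1 else 0)"
  using assms cube_index_less[of x N y z] cube_index_less[of x' N y' z']
  by (auto simp: ket3_def index_eq_iff)

lemma cube_index_cases:
  assumes "p < (N :: nat) ^ 3"
  obtains x y z where "x < N" "y < N" "z < N" "p = (x * N + y) * N + z"
proof -
  have p: "p < N ^ 2 * N" using assms by (simp add: eval_nat_numeral mult_ac)
  obtain x y where "x < N" "y < N" "p div N = x * N + y"
    using square_index_cases[OF div_less_mult[OF p]] .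
  then show ?thesis using that[of x y "p mod N"] mod_less_mult[OF p] by (metis div_mult_mod_eq)
qed

lemma vec_eq_ket3:
  assumes "v \<in> carrier_vec (N ^ 3)" "w \<in> carrier_vec (N ^ 3)"
    and "\<And>x y z. x < N \<Longrightarrow> y < N \<Longrightarrow> z < N \<Longrightarrow>
      v $ ((x * N + y) * N + z) = w $ ((x * N + y) * N + z)"
  shows "v = w"
  using assms by (intro eq_vecI) (auto elim: cube_index_cases)

lemma index_mult_ket3:
  assumes "M \<in> carrier_mat (N ^ 3) (N ^ 3)" "p < N ^ 3" "x < N" "y < N" "z < N"
  shows "(M *\<^sub>v ket3 N x y z) $ p = M $$ (p, (x * N + y) * N + z)"
  using assms cube_index_less[OF assms(3-5)] by (simp add: ket3_def)

lemma mat_eq_ket3_iff: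
  assumes "M \<in> carrier_mat (N ^ 3) (N ^ 3)" "M' \<in> carrier_mat (N ^ 3) (N ^ 3)"
  shows "M = M' \<longleftrightarrow> (\<forall>x<N. \<forall>y<N. \<forall>z<N. M *\<^sub>v ket3 N x y z = M' *\<^sub>v ket3 N x y z)"
proof
  assume eq: "\<forall>x<N. \<forall>y<N. \<forall>z<N. M *\<^sub>v ket3 N x y z = M' *\<^sub>v ket3 N x y z"
  show "M = M'"
  proof (rule eq_matI)
    fix i j assume ij: "i < dim_row M'" "j < dim_col M'"
    then have "j < N ^ 3" using assms by simp
    then obtain x y z where j: "x < N" "y < N" "z < N" "j = (x * N + y) * N + z"
      by (rule cube_index_cases)
    have "(M *\<^sub>v ket3 N x y z) $ i = M $$ (i, j)" "(M' *\<^sub>v ket3 N x y z) $ i = M' $$ (i, j)"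
      unfolding j(4) using assms ij j(1-3) by (simp_all only: index_mult_ket3 carrier_matD)
    then show "M $$ (i, j) = M' $$ (i, j)" using eq j by metis
  qed (use assms in auto)
qed simp

context
  fixes N :: nat and R :: "complex mat"
  assumes cc: "charge_conserving N R"
begin

private abbreviation "A \<equiv> coeff_a N R"
private abbreviation "B \<equiv> swap_coeff N R"
private abbreviation "R12 \<equiv> kron R (1\<^sub>m N)"
private abbreviation "R23 \<equiv> kron (1\<^sub>m N) R"
private abbreviation "e \<equiv> ket3 N"

lemma carrier_R: "R \<in> carrier_mat (N ^ 2) (N ^ 2)"
  using cc by (simp add: charge_conserving_def)

lemma carrier_R12: "R12 \<in> carrier_mat (N ^ 3) (N ^ 3)"
  using kron_carrier[OF carrier_R one_carrier_mat[of N]] by (simp add: eval_nat_numeral mult_ac)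

lemma carrier_R23: "R23 \<in> carrier_mat (N ^ 3) (N ^ 3)"
  using kron_carrier[OF one_carrier_mat[of N] carrier_R] by (simp add: eval_nat_numeral mult_ac)

lemma dim_ket3: "dim_vec (e x y z) = N ^ 3"
  by (simp add: ket3_def)

text \<open>An entry of \<open>R12\<close> or \<open>R23\<close> is a two-term entry of
  \<open>R\<close> times a Kronecker delta. Absorbing the delta into each condition yields the
  entries of two vectors \<open>ket3\<close>.\<close>

lemma scaled_indicators:
  fixes a b :: complex
  shows "((if P then a else 0) + (if Q then b else 0)) * (if C then 1 else 0) =
      a * (if P \<and> C then 1 else 0) + b * (if Q \<and> C then 1 else 0)"
    and "(if C then 1 else 0) * ((if P then a else 0) + (if Q then b else 0)) =
      a * (if C \<and> P then 1 else 0) + b * (if C \<and> Q then 1 else 0)"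
  by simp_all

lemma R12_ket3:
  assumes xyz: "x < N" "y < N" "z < N"
  shows "R12 *\<^sub>v e x y z = A x y \<cdot>\<^sub>v e x y z + B x y \<cdot>\<^sub>v e y x z" (is "_ = ?rhs")
proof (rule vec_eq_ket3[of _ N])
  fix x' y' z' assume *: "x' < N" "y' < N" "z' < N"
  define p where "p = (x' * N + y') * N + z'"
  have p: "p < N ^ 3" unfolding p_def by (rule cube_index_less[OF *])
  have "N ^ 3 = N ^ 2 * N" by (simp add: eval_nat_numeral)
  then have "R12 $$ (p, (x * N + y) * N + z) = R $$ (x' * N + y', x * N + y) * 1\<^sub>m N $$ (z', z)"
    using p cube_index_less[OF xyz] xyz * unfolding p_def
    by (subst index_kron[OF carrier_R one_carrier_mat[of N]]) auto
  then have "(R12 *\<^sub>v e x y z) $ p = R $$ (x' * N + y', x * N + y) * 1\<^sub>m N $$ (z', z)"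
    unfolding index_mult_ket3[OF carrier_R12 p xyz] .
  moreover have "?rhs $ p = A x y * e x y z $ p + B x y * e y x z $ p"
    using p by (simp add: dim_ket3)
  moreover have "R $$ (x' * N + y', x * N + y) * 1\<^sub>m N $$ (z', z) =
      A x y * e x y z $ p + B x y * e y x z $ p"
    unfolding p_def charge_conserving_index_pair[OF cc xyz(1,2) *(1,2)] index_ket3[OF xyz *]
      index_ket3[OF xyz(2,1,3) *] index_one_mat(1)[OF *(3) xyz(3)]
    by (simp only: scaled_indicators conj_assoc)
  ultimately show "(R12 *\<^sub>v e x y z) $ ((x' * N + y') * N + z') = ?rhs $ ((x' * N + y') * N + z')"
    unfolding p_def by (simp only:)
qed (use carrier_R12 in auto)

lemma R23_ket3:
  assumes xyz: "x < N" "y < N" "z < N"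
  shows "R23 *\<^sub>v e x y z = A y z \<cdot>\<^sub>v e x y z + B y z \<cdot>\<^sub>v e x z y" (is "_ = ?rhs")
proof (rule vec_eq_ket3[of _ N])
  fix x' y' z' assume *: "x' < N" "y' < N" "z' < N"
  define p where "p = (x' * N + y') * N + z'"
  have p: "p < N ^ 3" unfolding p_def by (rule cube_index_less[OF *])
  \<comment> \<open>The Horner form of a position separates the last letter under division by
    \<open>N\<close>. For \<open>R23\<close> it is regrouped so that division by
    \<open>N ^ 2\<close> separates the first letter.\<close>
  have split: "(u * N + v) * N + w = u * N ^ 2 + (v * N + w)" for u v w
    by (simp add: power2_eq_square algebra_simps)
  have dm: "((u * N + v) * N + w) div N ^ 2 = u" "((u * N + v) * N + w) mod N ^ 2 = v * N + w"
    if "v < N" "w < N" for u v w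
    using square_index_less[OF that] that unfolding split by simp_all
  have "N ^ 3 = N * N ^ 2" by (simp add: eval_nat_numeral)
  then have "R23 $$ (p, (x * N + y) * N + z) = 1\<^sub>m N $$ (x', x) * R $$ (y' * N + z', y * N + z)"
    using p cube_index_less[OF xyz] xyz * unfolding p_def
    by (subst index_kron[OF one_carrier_mat[of N] carrier_R]) (simp_all only: dm)
  then have "(R23 *\<^sub>v e x y z) $ p = 1\<^sub>m N $$ (x', x) * R $$ (y' * N + z', y * N + z)"
    unfolding index_mult_ket3[OF carrier_R23 p xyz] .
  moreover have "?rhs $ p = A y z * e x y z $ p + B y z * e x z y $ p"
    using p by (simp add: dim_ket3)
  moreover have "1\<^sub>m N $$ (x', x) * R $$ (y' * N + z', y * N + z) =
      A y z * e x y z $ p + B y z * e x z y $ p"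
    unfolding p_def charge_conserving_index_pair[OF cc xyz(2,3) *(2,3)] index_ket3[OF xyz *]
      index_ket3[OF xyz(1,3,2) *] index_one_mat(1)[OF *(1) xyz(1)]
    by (simp only: scaled_indicators)
  ultimately show "(R23 *\<^sub>v e x y z) $ ((x' * N + y') * N + z') = ?rhs $ ((x' * N + y') * N + z')"
    unfolding p_def by (simp only:)
qed (use carrier_R23 in auto)

lemma R12_R23_linear:
  assumes "u \<in> carrier_vec (N ^ 3)" "v \<in> carrier_vec (N ^ 3)"
  shows "R12 *\<^sub>v (a \<cdot>\<^sub>v u + b \<cdot>\<^sub>v v) = a \<cdot>\<^sub>v (R12 *\<^sub>v u) + b \<cdot>\<^sub>v (R12 *\<^sub>v v)"
    and "R23 *\<^sub>v (a \<cdot>\<^sub>v u + b \<cdot>\<^sub>v v) = a \<cdot>\<^sub>v (R23 *\<^sub>v u) + b \<cdot>\<^sub>v (R23 *\<^sub>v v)"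
  using assms carrier_R12 carrier_R23
  by (simp_all add: mult_add_distrib_mat_vec[of _ "N ^ 3" "N ^ 3"] mult_mat_vec[of _ "N ^ 3" "N ^ 3"])

text \<open>Both sides are expanded letter swap by letter swap. Working at a fixed entry
  \<open>p\<close> keeps this an identity of complex numbers, valid even when some of the three kets
  coincide.\<close>

lemma yang_baxter_defect:
  assumes "x < N" "y < N" "z < N" "p < N ^ 3"
  shows "(R12 *\<^sub>v (R23 *\<^sub>v (R12 *\<^sub>v e x y z))) $ p - (R23 *\<^sub>v (R12 *\<^sub>v (R23 *\<^sub>v e x y z))) $ p =
    ((A x y)^2 * A y z + B x y * B y x * A x z - (A y z)^2 * A x y - B y z * B z y * A x z) * e x y z $ p +
    B x y * (A x y * A y z + A x z * A y x - A y z * A x z) * e y x z $ p +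
    B y z * (A x y * A x z - A y z * A x y - A x z * A z y) * e x z y $ p"
proof -
  have "(R12 *\<^sub>v (R23 *\<^sub>v (R12 *\<^sub>v e x y z))) $ p =
      A x y * (A y z * (A x y * e x y z $ p + B x y * e y x z $ p) +
               B y z * (A x z * e x z y $ p + B x z * e z x y $ p)) +
      B x y * (A x z * (A y x * e y x z $ p + B y x * e x y z $ p) +
               B x z * (A y z * e y z x $ p + B y z * e z y x $ p))"
    using assms by (simp add: R12_ket3 R23_ket3 R12_R23_linear dim_ket3)
  moreover have "(R23 *\<^sub>v (R12 *\<^sub>v (R23 *\<^sub>v e x y z))) $ p =
      A y z * (A x y * (A y z * e x y z $ p + B y z * e x z y $ p) +
               B x y * (A x z * e y x z $ p + B x z * e y z x $ p)) +
      B y z * (A x z * (A z y * e x z y $ p + B z y * e x y z $ p) +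
               B x z * (A x y * e z x y $ p + B x y * e z y x $ p))"
    using assms by (simp add: R12_ket3 R23_ket3 R12_R23_linear dim_ket3)
  ultimately show ?thesis by (simp add: algebra_simps power2_eq_square)
qed

end

text \<open>The three expressions are the coefficients of \<open>|xyz>\<close>, \<open>|yxz>\<close>
  and \<open>|xzy>\<close> in \<open>yang_baxter_defect\<close>.\<close>

definition yb_equations ::
  "(nat \<Rightarrow> nat \<Rightarrow> complex) \<Rightarrow> (nat \<Rightarrow> nat \<Rightarrow> complex) \<Rightarrow> nat \<Rightarrow> nat \<Rightarrow> nat \<Rightarrow> bool" where
  "yb_equations A B x y z \<longleftrightarrow>
     (A x y)^2 * A y z + B x y * B y x * A x z - (A y z)^2 * A x y - B y z * B z y * A x z = 0 \<and>
     B x y * (A x y * A y z + A x z * A y x - A y z * A x z) = 0 \<and>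
     B y z * (A x y * A x z - A y z * A x y - A x z * A z y) = 0"

lemma yang_baxter_iff_equations:
  assumes cc: "charge_conserving N R"
  shows "yang_baxter N R \<longleftrightarrow>
    (\<forall>x<N. \<forall>y<N. \<forall>z<N. yb_equations (coeff_a N R) (swap_coeff N R) x y z)"
proof -
  let ?M = "kron R (1\<^sub>m N)" and ?M' = "kron (1\<^sub>m N) R" and ?e = "ket3 N"
  let ?A = "coeff_a N R" and ?B = "swap_coeff N R"
  let ?L = "\<lambda>x y z. ?M *\<^sub>v (?M' *\<^sub>v (?M *\<^sub>v ?e x y z))"
  let ?L' = "\<lambda>x y z. ?M' *\<^sub>v (?M *\<^sub>v (?M' *\<^sub>v ?e x y z))"
  note M = carrier_R12[OF cc] carrier_R23[OF cc]
  have assoc: "(P * Q * P) *\<^sub>v ?e x y z = P *\<^sub>v (Q *\<^sub>v (P *\<^sub>v ?e x y z))"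
    if "P \<in> carrier_mat (N ^ 3) (N ^ 3)" "Q \<in> carrier_mat (N ^ 3) (N ^ 3)" for P Q x y z
    using that by (simp add: assoc_mult_mat_vec[of _ "N ^ 3" "N ^ 3" _ "N ^ 3"]
        mult_carrier_mat[of _ "N ^ 3" "N ^ 3"])
  have carr: "?M * ?M' * ?M \<in> carrier_mat (N ^ 3) (N ^ 3)" "?M' * ?M * ?M' \<in> carrier_mat (N ^ 3) (N ^ 3)"
    using M by (auto intro!: mult_carrier_mat)
  have yb: "yang_baxter N R \<longleftrightarrow> (\<forall>x<N. \<forall>y<N. \<forall>z<N. ?L x y z = ?L' x y z)"
    unfolding yang_baxter_def mat_eq_ket3_iff[OF carr] assoc[OF M] assoc[OF M(2,1)] ..
  have "?L x y z = ?L' x y z \<longleftrightarrow> yb_equations ?A ?B x y z" if xyz: "x < N" "y < N" "z < N" for x y z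
  proof
    assume yb: "yb_equations ?A ?B x y z"
    have "?L x y z $ p = ?L' x y z $ p" if "p < N ^ 3" for p
    proof -
      note eqs = yb[unfolded yb_equations_def, THEN conjunct1]
        yb[unfolded yb_equations_def, THEN conjunct2, THEN conjunct1]
        yb[unfolded yb_equations_def, THEN conjunct2, THEN conjunct2]
      have "?L x y z $ p - ?L' x y z $ p = 0"
        unfolding yang_baxter_defect[OF cc xyz that] eqs by simp
      then show ?thesis by simp
    qed
    then show "?L x y z = ?L' x y z" using M by (intro eq_vecI) auto
  next
    assume eq: "?L x y z = ?L' x y z"
    \<comment> \<open>The defect now vanishes at every position; \<open>d1\<close>,
      \<open>d2\<close> and \<open>d3\<close> are its values at the words \<open>xyz\<close>,
      \<open>yxz\<close> and \<open>xzy\<close>.\<close>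
    note d = yang_baxter_defect[OF cc xyz cube_index_less, unfolded eq diff_self]
    note d1 = d[OF xyz, unfolded index_ket3[OF xyz xyz] index_ket3[OF xyz(2,1,3) xyz]
        index_ket3[OF xyz(1,3,2) xyz]]
    note d2 = d[OF xyz(2,1,3), unfolded index_ket3[OF xyz xyz(2,1,3)]
        index_ket3[OF xyz(2,1,3) xyz(2,1,3)] index_ket3[OF xyz(1,3,2) xyz(2,1,3)]]
    note d3 = d[OF xyz(1,3,2), unfolded index_ket3[OF xyz xyz(1,3,2)]
        index_ket3[OF xyz(2,1,3) xyz(1,3,2)] index_ket3[OF xyz(1,3,2) xyz(1,3,2)]]
    \<comment> \<open>The three kets are distinct unless \<open>x = y\<close> or
      \<open>y = z\<close>. In these cases the zero diagonal of \<open>swap_coeff\<close> removes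
      the coefficient of the merging ket, so each coefficient vanishes separately.\<close>
    have B0: "?B u u = 0" for u by (simp add: swap_coeff_def)
    show "yb_equations ?A ?B x y z"
      unfolding yb_equations_def
    proof (intro conjI)
      show "?B x y * (?A x y * ?A y z + ?A x z * ?A y x - ?A y z * ?A x z) = 0"
        using d2 by (cases "x = y") (simp_all add: B0)
      show "?B y z * (?A x y * ?A x z - ?A y z * ?A x y - ?A x z * ?A z y) = 0"
        using d3 by (cases "y = z") (simp_all add: B0)
      show "(?A x y)^2 * ?A y z + ?B x y * ?B y x * ?A x z - (?A y z)^2 * ?A x y
          - ?B y z * ?B z y * ?A x z = 0"
        using d1 by (cases "x = y"; cases "y = z") (simp_all add: B0)
    qed
  qed
  then show ?thesis unfolding yb by blast
qed


section \<open>Comparison with the constraints on triples\<close>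

text \<open>These are the \<open>basic_constraints\<close> at labels \<open>x\<close>,
  \<open>y\<close>, \<open>z\<close>, with \<open>c\<close> and \<open>d\<close> rewritten as
  \<open>b\<close> and \<open>a\<close> at exchanged indices. Keeping \<open>B\<close> a parameter
  allows both \<open>coeff_b\<close> and \<open>swap_coeff\<close>.\<close>

definition triple_constraints ::
  "(nat \<Rightarrow> nat \<Rightarrow> complex) \<Rightarrow> (nat \<Rightarrow> nat \<Rightarrow> complex) \<Rightarrow> nat \<Rightarrow> nat \<Rightarrow> nat \<Rightarrow> bool" where
  "triple_constraints A B x y z \<longleftrightarrow>
     A x y * ((A x x)^2 - A x y * A x x - B x y * B y x) = 0 \<and>
     A x y * ((A y y)^2 - A x y * A y y - B x y * B y x) = 0 \<and>
     A x y * B y x * A y x = 0 \<and>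
     A x y * B x y * A y x = 0 \<and>
     A x y * A y x * (A x y - A y x) = 0 \<and>
     B y x * (A z x * A z y - A y x * A z y - A x y * A z x) = 0 \<and>
     B y x * (- A x z * A y z + A x y * A y z + A y x * A x z) = 0 \<and>
     - A x z * (A z y)^2 + (A x z)^2 * A z y - A x y * B y z * B z y + A x y * B x z * B z x = 0"

lemma eq_neg_zero: "x = - y \<Longrightarrow> y = 0 \<Longrightarrow> x = (0 :: complex)"
  by simp

text \<open>Each constraint is, up to sign, one component of \<open>yb_equations\<close> at a
  suitable word: the first five come from words with a repeated letter, the last three from
  permutations of \<open>xyz\<close>.\<close>

lemma triple_constraints_if_equations:
  assumes yb: "\<And>u v w. {u, v, w} \<subseteq> {x, y, z} \<Longrightarrow> yb_equations A B u v w"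
    and B: "B x x = 0" "B y y = 0"
  shows "triple_constraints A B x y z"
proof -
  have xxy: "yb_equations A B x x y" by (rule yb) auto
  have xyy: "yb_equations A B x y y" by (rule yb) auto
  have yyx: "yb_equations A B y y x" by (rule yb) auto
  have xyx: "yb_equations A B x y x" by (rule yb) auto
  have zyx: "yb_equations A B z y x" by (rule yb) auto
  have yxz: "yb_equations A B y x z" by (rule yb) auto
  have xzy: "yb_equations A B x z y" by (rule yb) auto
  note eqs = xxy xyy yyx xyx zyx yxz xzy
  note eqs = eqs[unfolded yb_equations_def]
  show ?thesis unfolding triple_constraints_def
  proof (intro conjI)
    show "A x y * ((A x x)^2 - A x y * A x x - B x y * B y x) = 0"
      by (rule trans[OF _ eqs(1)[THEN conjunct1]])
        (simp add: B algebra_simps power2_eq_square)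
    show "A x y * ((A y y)^2 - A x y * A y y - B x y * B y x) = 0"
      by (rule eq_neg_zero[OF _ eqs(2)[THEN conjunct1]])
        (simp add: B algebra_simps power2_eq_square)
    show "A x y * B y x * A y x = 0"
      by (rule eq_neg_zero[OF _ eqs(3)[THEN conjunct2, THEN conjunct2]])
        (simp add: B algebra_simps power2_eq_square)
    show "A x y * B x y * A y x = 0"
      by (rule eq_neg_zero[OF _ eqs(1)[THEN conjunct2, THEN conjunct2]])
        (simp add: B algebra_simps power2_eq_square)
    show "A x y * A y x * (A x y - A y x) = 0"
      by (rule trans[OF _ eqs(4)[THEN conjunct1]])
        (simp add: B algebra_simps power2_eq_square)
    show "B y x * (A z x * A z y - A y x * A z y - A x y * A z x) = 0"
      by (rule trans[OF _ eqs(5)[THEN conjunct2, THEN conjunct2]])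
        (simp add: B algebra_simps power2_eq_square)
    show "B y x * (- A x z * A y z + A x y * A y z + A y x * A x z) = 0"
      by (rule trans[OF _ eqs(6)[THEN conjunct2, THEN conjunct1]])
        (simp add: B algebra_simps power2_eq_square)
    show "- A x z * (A z y)^2 + (A x z)^2 * A z y - A x y * B y z * B z y + A x y * B x z * B z x = 0"
      by (rule trans[OF _ eqs(7)[THEN conjunct1]])
        (simp add: B algebra_simps power2_eq_square)
  qed
qed

text \<open>The words are sorted by which letters coincide. With exactly two labels the first five
  constraints suffice, with three distinct labels the last three.\<close>

lemma equations_if_triple_constraints:
  fixes N :: nat
  assumes N: "N \<ge> 3" and B: "\<And>u. B u u = 0"
    and tr: "\<And>u v w. \<lbrakk>u < N; v < N; w < N; distinct [u, v, w]\<rbrakk> \<Longrightarrow> triple_constraints A B u v w"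
    and xyz: "x < N" "y < N" "z < N"
  shows "yb_equations A B x y z"
proof -
  have pair: "A u v * ((A u u)^2 - A u v * A u u - B u v * B v u) = 0 \<and>
     A u v * ((A v v)^2 - A u v * A v v - B u v * B v u) = 0 \<and>
     A u v * B v u * A v u = 0 \<and> A u v * B u v * A v u = 0 \<and>
     A u v * A v u * (A u v - A v u) = 0"
    if "u < N" "v < N" "u \<noteq> v" for u v
  proof -
    \<comment> \<open>A spare third label turns the pair into a triple; as \<open>N \<ge> 3\<close>,
      one of \<open>0, 1, 2\<close> differs from both \<open>u\<close> and \<open>v\<close>.\<close>
    have "\<exists>w<3. w \<noteq> u \<and> w \<noteq> v" by presburger
    then obtain w where "w < 3" "w \<noteq> u" "w \<noteq> v" by blast
    then have "triple_constraints A B u v w" using that N by (intro tr) auto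
    then show ?thesis unfolding triple_constraints_def by blast
  qed
  consider "x = y" "y = z" | "x = y" "y \<noteq> z" | "x \<noteq> y" "y = z" | "x = z" "x \<noteq> y" | "distinct [x, y, z]"
    by auto
  then show ?thesis
  proof cases
    case 1
    then show ?thesis by (simp add: yb_equations_def B)
  next
    case 2
    have p: "A y z * ((A y y)^2 - A y z * A y y - B y z * B z y) = 0" "A y z * B y z * A z y = 0"
      using pair[OF xyz(2,3) 2(2)] by blast+
    show ?thesis unfolding yb_equations_def 2(1)
      apply (intro conjI)
      subgoal by (rule trans[OF _ p(1)]) (simp add: B algebra_simps power2_eq_square)
      subgoal by (simp add: B algebra_simps power2_eq_square)
      subgoal by (rule eq_neg_zero[OF _ p(2)]) (simp add: B algebra_simps power2_eq_square)
      done
  next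
    case 3
    have p: "A x y * ((A y y)^2 - A x y * A y y - B x y * B y x) = 0" "A x y * B x y * A y x = 0"
      using pair[OF xyz(1,2) 3(1)] by blast+
    show ?thesis unfolding yb_equations_def 3(2)[symmetric]
      apply (intro conjI)
      subgoal by (rule eq_neg_zero[OF _ p(1)]) (simp add: B algebra_simps power2_eq_square)
      subgoal by (rule trans[OF _ p(2)]) (simp add: B algebra_simps power2_eq_square)
      subgoal by (simp add: B algebra_simps power2_eq_square)
      done
  next
    case 4
    have p: "A x y * A y x * (A x y - A y x) = 0" "A x y * B x y * A y x = 0" "A x y * B y x * A y x = 0"
      using pair[OF xyz(1,2) 4(2)] by blast+
    show ?thesis unfolding yb_equations_def 4(1)[symmetric]
      apply (intro conjI)
      subgoal by (rule trans[OF _ p(1)]) (simp add: B algebra_simps power2_eq_square)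
      subgoal by (rule trans[OF _ p(2)]) (simp add: B algebra_simps power2_eq_square)
      subgoal by (rule eq_neg_zero[OF _ p(3)]) (simp add: B algebra_simps power2_eq_square)
      done
  next
    case 5
    then have dist: "distinct [z, y, x]" "distinct [y, x, z]" "distinct [x, z, y]" by auto
    \<comment> \<open>The words \<open>zyx\<close>, \<open>yxz\<close> and \<open>xzy\<close> arise
      from \<open>xyz\<close> by transpositions, so the matching of constraints with equations used
      in \<open>triple_constraints_if_equations\<close> is its own inverse.\<close>
    have p: "B y z * (A x z * A x y - A y z * A x y - A z y * A x z) = 0"
      "B x y * (- A y z * A x z + A y x * A x z + A x y * A y z) = 0"
      "- A x y * (A y z)^2 + (A x y)^2 * A y z - A x z * B z y * B y z + A x z * B x y * B y x = 0"
      using tr[OF xyz(3,2,1) dist(1)] tr[OF xyz(2,1,3) dist(2)] tr[OF xyz(1,3,2) dist(3)]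
      unfolding triple_constraints_def by blast+
    show ?thesis unfolding yb_equations_def
      apply (intro conjI)
      subgoal by (rule trans[OF _ p(3)]) (simp add: B algebra_simps power2_eq_square)
      subgoal by (rule trans[OF _ p(2)]) (simp add: B algebra_simps power2_eq_square)
      subgoal by (rule trans[OF _ p(1)]) (simp add: B algebra_simps power2_eq_square)
      done
  qed
qed

section \<open>Restrictions to three labels\<close>

lemma coeff_c_eq: "coeff_c N R i j = coeff_b N R j i"
  by (simp add: coeff_b_def coeff_c_def)

lemma coeff_d_eq: "coeff_d N R i j = coeff_a N R j i"
  by (simp add: coeff_a_def coeff_d_def)

lemma coeff_restriction3:
  assumes "u < 3" "v < 3"
  shows "coeff_a 3 (restriction3 N R i j k) u v = coeff_a N R ([i, j, k] ! u) ([i, j, k] ! v)"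
    and "coeff_b 3 (restriction3 N R i j k) u v = coeff_b N R ([i, j, k] ! u) ([i, j, k] ! v)"
proof -
  have "u * 3 + v < 3\<^sup>2" "v * 3 + u < 3\<^sup>2" using assms by auto
  moreover have "(u * 3 + v) div 3 = u" "(u * 3 + v) mod 3 = v"
    "(v * 3 + u) div 3 = v" "(v * 3 + u) mod 3 = u" using assms by auto
  ultimately show
    "coeff_a 3 (restriction3 N R i j k) u v = coeff_a N R ([i, j, k] ! u) ([i, j, k] ! v)"
    "coeff_b 3 (restriction3 N R i j k) u v = coeff_b N R ([i, j, k] ! u) ([i, j, k] ! v)"
    by (simp_all only: coeff_a_def coeff_b_def restriction3_def Let_def index_mat prod.case)
qed

lemma distinct_triple:
  assumes "{x, y, z} = {i, j, k}" "distinct [i, j, k]"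
  shows "distinct [x, y, z]"
proof -
  have "card {x, y, z} = 3" using assms(2) unfolding assms(1) by simp
  then show ?thesis by (auto simp: card_insert_if split: if_splits)
qed

text \<open>Following a permutation of \<open>0, 1, 2\<close> by the relabelling to
  \<open>i, j, k\<close> produces exactly the orderings of \<open>{i, j, k}\<close>, so quantifying
  over permutations becomes quantifying over ordered triples.\<close>

lemma rank3_constraints_restriction3:
  assumes ijk: "distinct [i, j, k]"
  shows "rank3_constraints (restriction3 N R i j k) \<longleftrightarrow>
    (\<forall>x y z. {x, y, z} = {i, j, k} \<longrightarrow> triple_constraints (coeff_a N R) (coeff_b N R) x y z)"
proof -
  let ?S = "restriction3 N R i j k" and ?l = "[i, j, k]"
  let ?T = "triple_constraints (coeff_a N R) (coeff_b N R)"
  have three: "{0..<3} = {0, 1, 2 :: nat}" by auto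
  have "rank3_constraints ?S \<longleftrightarrow> (\<forall>\<omega>. \<omega> permutes {0..<3} \<longrightarrow>
      triple_constraints (coeff_a 3 ?S) (coeff_b 3 ?S) (\<omega> 0) (\<omega> 1) (\<omega> 2))"
    unfolding rank3_constraints_def basic_constraints_def triple_constraints_def
      coeff_c_eq coeff_d_eq by (simp add: mult.commute mult.left_commute)
  also have "\<dots> \<longleftrightarrow> (\<forall>\<omega>. \<omega> permutes {0..<3} \<longrightarrow> ?T (?l ! \<omega> 0) (?l ! \<omega> 1) (?l ! \<omega> 2))"
  proof (intro all_cong1 imp_cong refl)
    fix \<omega> :: "nat \<Rightarrow> nat" assume "\<omega> permutes {0..<3}"
    then have "\<omega> 0 < 3" "\<omega> 1 < 3" "\<omega> 2 < 3"
      using permutes_in_image[of \<omega> "{0..<3}"] by auto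
    then show "triple_constraints (coeff_a 3 ?S) (coeff_b 3 ?S) (\<omega> 0) (\<omega> 1) (\<omega> 2) =
        ?T (?l ! \<omega> 0) (?l ! \<omega> 1) (?l ! \<omega> 2)"
      unfolding triple_constraints_def by (simp only: coeff_restriction3)
  qed
  also have "\<dots> \<longleftrightarrow> (\<forall>x y z. {x, y, z} = {i, j, k} \<longrightarrow> ?T x y z)"
  proof (intro iffI allI impI)
    fix \<omega> :: "nat \<Rightarrow> nat"
    assume *: "\<forall>x y z. {x, y, z} = {i, j, k} \<longrightarrow> ?T x y z" and "\<omega> permutes {0..<3}"
    then have "{\<omega> 0, \<omega> 1, \<omega> 2} = {0, 1, 2}" using permutes_image[of \<omega> "{0..<3}"] three by simp
    then have "(!) ?l ` {\<omega> 0, \<omega> 1, \<omega> 2} = (!) ?l ` {0, 1, 2}" by (rule arg_cong)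
    also have "\<dots> = {i, j, k}" by simp
    finally show "?T (?l ! \<omega> 0) (?l ! \<omega> 1) (?l ! \<omega> 2)" using * by simp
  next
    fix x y z
    assume *: "\<forall>\<omega>. \<omega> permutes {0..<3} \<longrightarrow> ?T (?l ! \<omega> 0) (?l ! \<omega> 1) (?l ! \<omega> 2)"
      and xyz: "{x, y, z} = {i, j, k}"
    have dist: "distinct [x, y, z]" using xyz ijk by (rule distinct_triple)
    have "x \<in> set ?l" "y \<in> set ?l" "z \<in> set ?l" using xyz by auto
    then obtain u v w where "u < length ?l" "v < length ?l" "w < length ?l"
      and nth: "?l ! u = x" "?l ! v = y" "?l ! w = z"
      unfolding in_set_conv_nth by (elim exE conjE)
    then have uvw: "u < 3" "v < 3" "w < 3" by simp_all
    \<comment> \<open>The positions of \<open>x\<close>, \<open>y\<close>, \<open>z\<close> in the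
      list prescribe the permutation; outside \<open>{0..<3}\<close> it is the identity, as
      \<open>permutes\<close> demands.\<close>
    define \<omega> where "\<omega> = (\<lambda>n :: nat. if n = 0 then u else if n = 1 then v else if n = 2 then w else n)"
    have \<omega>: "\<omega> 0 = u" "\<omega> 1 = v" "\<omega> 2 = w" by (simp_all add: \<omega>_def)
    have "inj_on \<omega> {0..<3}"
      unfolding three inj_on_def using dist nth by (auto simp: \<omega>_def)
    moreover have "\<omega> ` {0..<3} \<subseteq> {0..<3}" unfolding three using uvw by (auto simp: \<omega>_def)
    ultimately have "bij_betw \<omega> {0..<3} {0..<3}"
      by (simp add: bij_betw_def endo_inj_surj)
    then have "\<omega> permutes {0..<3}" by (rule bij_imp_permutes) (auto simp: \<omega>_def)
    with * show "?T x y z" using nth \<omega> by metis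
  qed
  finally show ?thesis .
qed

lemma ex_sorted_triple:
  fixes x y z :: "'a :: linorder"
  assumes "distinct [x, y, z]"
  obtains i j k where "i < j" "j < k" "{x, y, z} = {i, j, k}"
proof -
  consider "x < y" "y < z" | "x < z" "z < y" | "y < x" "x < z" | "y < z" "z < x" | "z < x" "x < y" | "z < y" "y < x"
    using assms by (auto simp: neq_iff)
  then show ?thesis
  proof cases
    case 1
    then show ?thesis by (rule that) auto
  next
    case 2
    then show ?thesis by (rule that) auto
  next
    case 3
    then show ?thesis by (rule that) auto
  next
    case 4
    then show ?thesis by (rule that) auto
  next
    case 5
    then show ?thesis by (rule that) auto
  next
    case 6
    then show ?thesis by (rule that) auto
  qed
qed

text \<open>Any three distinct labels can be listed increasingly, so the restrictions together
  impose \<open>triple_constraints\<close> on all distinct triples; the two preceding comparisons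
  turn these into \<open>yb_equations\<close>.\<close>

lemma restrictions_iff_equations:
  assumes N: "N \<ge> 3"
  shows "(\<forall>i j k. i < j \<and> j < k \<and> k < N \<longrightarrow> rank3_constraints (restriction3 N R i j k)) \<longleftrightarrow>
    (\<forall>x<N. \<forall>y<N. \<forall>z<N. yb_equations (coeff_a N R) (swap_coeff N R) x y z)"
proof -
  let ?A = "coeff_a N R" and ?B = "swap_coeff N R"
  \<comment> \<open>No diagonal value of \<open>B\<close> occurs in
    \<open>triple_constraints\<close> at distinct labels, and off the diagonal
    \<open>swap_coeff\<close> agrees with \<open>coeff_b\<close>.\<close>
  have swap: "triple_constraints ?A (coeff_b N R) x y z \<longleftrightarrow> triple_constraints ?A ?B x y z"
    if "distinct [x, y, z]" for x y z
    using that by (auto simp: triple_constraints_def swap_coeff_def)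
  have r3: "rank3_constraints (restriction3 N R i j k) \<longleftrightarrow>
      (\<forall>x y z. {x, y, z} = {i, j, k} \<longrightarrow> triple_constraints ?A ?B x y z)" if "i < j" "j < k" for i j k
  proof -
    have ijk: "distinct [i, j, k]" using that by auto
    show ?thesis unfolding rank3_constraints_restriction3[OF ijk]
      by (intro all_cong1 imp_cong refl swap) (rule distinct_triple[OF _ ijk])
  qed
  have B: "?B u u = 0" for u by (simp add: swap_coeff_def)
  show ?thesis
  proof
    assume L: "\<forall>i j k. i < j \<and> j < k \<and> k < N \<longrightarrow> rank3_constraints (restriction3 N R i j k)"
    have tr: "triple_constraints ?A ?B u v w" if uvw: "u < N" "v < N" "w < N" "distinct [u, v, w]" for u v w
    proof -
      obtain i j k where ijk: "i < j" "j < k" "{u, v, w} = {i, j, k}"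
        using uvw(4) by (rule ex_sorted_triple)
      have "k \<in> {u, v, w}" unfolding ijk(3) by simp
      then have "k < N" using uvw(1-3) by auto
      then have "rank3_constraints (restriction3 N R i j k)" using L ijk(1,2) by blast
      then show ?thesis unfolding r3[OF ijk(1,2)] using ijk(3) by simp
    qed
    show "\<forall>x<N. \<forall>y<N. \<forall>z<N. yb_equations ?A ?B x y z"
      by (intro allI impI, rule equations_if_triple_constraints[where A = ?A and B = ?B, OF N B tr])
  next
    assume E: "\<forall>x<N. \<forall>y<N. \<forall>z<N. yb_equations ?A ?B x y z"
    show "\<forall>i j k. i < j \<and> j < k \<and> k < N \<longrightarrow> rank3_constraints (restriction3 N R i j k)"
    proof (intro allI impI)
      fix i j k assume ijk: "i < j \<and> j < k \<and> k < N"
      have "triple_constraints ?A ?B x y z" if xyz: "{x, y, z} = {i, j, k}" for x y z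
      proof (rule triple_constraints_if_equations[where A = ?A and B = ?B, OF _ B B])
        fix u v w assume "{u, v, w} \<subseteq> {x, y, z}"
        then have "u < N" "v < N" "w < N" unfolding xyz using ijk by auto
        then show "yb_equations ?A ?B u v w" using E by simp
      qed
      then show "rank3_constraints (restriction3 N R i j k)" using r3 ijk by simp
    qed
  qed
qed

theorem lemma3p13:
  fixes N :: nat and R :: "complex mat"
  assumes "N \<ge> 3"
    and "charge_conserving N R"
    and "invertible_mat R"
  shows "((\<exists>Fo Fm. strict_monoidal_functor braid_cat (match_cat N) Fo Fm \<and>
             Fo 1 = 1 \<and> Fm braid_sigma = R) \<longleftrightarrow>
          (\<forall>i j k. i < j \<and> j < k \<and> k < N \<longrightarrow> rank3_constraints (restriction3 N R i j k))) \<and>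
         ((\<exists>Fo Fm. strict_monoidal_functor braid_cat (match_cat N) Fo Fm \<and>
             Fo 1 = 1 \<and> Fm braid_sigma = R) \<longleftrightarrow>
          yang_baxter N R)"
  using functor_iff_yang_baxter[OF _ assms(2,3)] yang_baxter_iff_equations[OF assms(2)]
    restrictions_iff_equations[OF assms(1)] assms(1) by simp

end
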